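(* Let $G$ be a countable infinite discrete amenable group acting continuously on a compact metric space $(X,d)$, and let $\{F_n\}_{n=1}^{\infty}$ be a Følner sequence in $G$ with $|F_n|$ increasing and $|F_n|\to\infty$. Let $\Phi:X\to\mathbb{R}$ be a positive continuous function and let $H$ be a non-empty compact subset of $X$. Then $$\begin{aligned} \dim_H^{\widetilde{BS}}(\{F_n\}_{n=1}^{\infty},\Phi)&=\sup\{\underline{P}_{\mu}^{\widetilde{BK}}(\{F_n\}_{n=1}^{\infty},\Phi):\mu\in M(X),\ \mu(H)=1\}\\ &=\sup\{\dim_{\mu}^{\widetilde{BS}}(\{F_n\}_{n=1}^{\infty},\Phi):\mu\in M(X),\ \mu(H)=1\}\\ &=\sup\{\dim_{\mu}^{\widetilde{K}}(\{F_n\}_{n=1}^{\infty},\Phi):\mu\in M(X),\ \mu(H)=1\}. \end{aligned}$$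
   Context: A Følner sequence in $G$ is a sequence of non-empty finite subsets $F_n\subset G$ with $\lim_{n\to\infty}|F_n\triangle gF_n|/|F_n|=0$ for every $g\in G$. $M(X)$ is the set of Borel probability measures on $X$. For finite $F\subset G$: $d_F(x,y)=\max_{g\in F}d(gx,gy)$, $B_F(x,\epsilon)=\{y\in X:d_F(x,y)<\epsilon\}$, and $\Phi_F(x)=\sum_{g\in F}\Phi(gx)$. All quantities take values in $[0,\infty]$; in critical values below $s$ ranges over $s>0$, with $\sup\emptyset=0$, $\inf\emptyset=\infty$. BS dimension of a set. For non-empty $H\subset X$, $\epsilon>0$, $N\in\mathbb{N}$, $s>0$ let $$M^{s}_{N,\epsilon}(H,\{F_n\},\Phi)=\inf\sum_{i\in I}\exp\Big[-s\sup_{y\in B_{F_{n_i}}(x_i,\epsilon)}\Phi_{F_{n_i}}(y)\Big],$$ the infimum over all finite or countable covers $\{B_{F_{n_i}}(x_i,\epsilon)\}_{i\in I}$ of $H$ with $n_i\ge N$, $x_i\in X$. Let $M^s_\epsilon(H,\{F_n\},\Phi)=\lim_{N\to\infty}M^s_{N,\epsilon}(H,\{F_n\},\Phi)$, $M_\epsilon(H,\{F_n\},\Phi)=\inf\{s:M^s_\epsilon=0\}=\sup\{s:M^s_\epsilon=\infty\}$, and $\dim_H^{\widetilde{BS}}(\{F_n\},\Phi)=\lim_{\epsilon\to0}M_\epsilon(H,\{F_n\},\Phi)$. Let $\widetilde M^s_{N,\epsilon}$, $\widetilde M^s_\epsilon$, $\widetilde M_\epsilon$ be defined in the same way with $\sup_{y\in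 B_{F_{n_i}}(x_i,\epsilon)}\Phi_{F_{n_i}}(y)$ replaced by $\Phi_{F_{n_i}}(x_i)$. Lower measure-theoretic BS dimension of $\mu\in M(X)$: $$\underline{P}_{\mu}^{\widetilde{BK}}(\{F_n\},\Phi)=\int\lim_{\epsilon\to0}\liminf_{n\to\infty}\frac{-\log\mu(B_{F_n}(x,\epsilon))}{\Phi_{F_n}(x)}\,d\mu(x).$$ BS dimension of $\mu$: $\dim_{\mu}^{\widetilde{BS}}(\{F_n\},\Phi)=\lim_{\epsilon\to0}\lim_{\delta\to0}\inf\{\widetilde M_\epsilon(Z,\{F_n\},\Phi):Z\subset X \text{ Borel},\ \mu(Z)\ge1-\delta\}$. BS dimension of $\mu$ in the sense of Katok: for $\delta\in(0,1)$ let $$\Lambda^s_{N,\epsilon}(\mu,\{F_n\},\Phi,\delta)=\inf\sum_{i\in I}\exp[-s\Phi_{F_{n_i}}(x_i)],$$ the infimum over all finite or countable families $\{B_{F_{n_i}}(x_i,\epsilon)\}_{i\in I}$ with $n_i\ge N$, $x_i\in X$ and $\mu(\bigcup_{i\in I}B_{F_{n_i}}(x_i,\epsilon))>1-\delta$; let $\Lambda^s_\epsilon=\lim_{N\to\infty}\Lambda^s_{N,\epsilon}$, $\Lambda_\epsilon(\mu,\{F_n\},\Phi,\delta)=\inf\{s:\Lambda^s_\epsilon=0\}=\sup\{s:\Lambda^s_\epsilon=\infty\}$, and $\dim_\mu^{\widetilde K}(\{F_n\},\Phi)=\lim_{\epsilon\to0}\lim_{\delta\to0}\Lambda_\epsilon(\mu,\{F_n\},\Phi,\delta)$.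 *)

theory Defs
  imports "HOL-Analysis.Analysis" "HOL-Probability.Probability" "HOL-Algebra.Group_Action"
begin

definition folner_sequence :: "('g, 'm) monoid_scheme \<Rightarrow> (nat \<Rightarrow> 'g set) \<Rightarrow> bool" where
  "folner_sequence G F \<longleftrightarrow>
     (\<forall>n. F n \<noteq> {} \<and> finite (F n) \<and> F n \<subseteq> carrier G) \<and>
     (\<forall>g\<in>carrier G.
        (\<lambda>n. real (card (sym_diff (F n) (g <#\<^bsub>G\<^esub> F n))) / real (card (F n))) \<longlonglongrightarrow> 0)"

(* Amenability of a countable discrete group. *)
definition amenable :: "('g, 'm) monoid_scheme \<Rightarrow> bool" where
  "amenable G \<longleftrightarrow> (\<exists>F. folner_sequence G F)"

definition borel_probs :: "'x::topological_space measure set" where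
  "borel_probs = {\<mu>. prob_space \<mu> \<and> sets \<mu> = sets borel}"

definition bowen_dist ::
  "('g \<Rightarrow> 'x::metric_space \<Rightarrow> 'x) \<Rightarrow> 'g set \<Rightarrow> 'x \<Rightarrow> 'x \<Rightarrow> real" where
  "bowen_dist act A x y = Max ((\<lambda>g. dist (act g x) (act g y)) ` A)"

definition bowen_ball ::
  "('g \<Rightarrow> 'x::metric_space \<Rightarrow> 'x) \<Rightarrow> 'g set \<Rightarrow> 'x \<Rightarrow> real \<Rightarrow> 'x set" where
  "bowen_ball act A x \<epsilon> = {y. bowen_dist act A x y < \<epsilon>}"

definition orbit_sum ::
  "('g \<Rightarrow> 'x \<Rightarrow> 'x) \<Rightarrow> ('x \<Rightarrow> real) \<Rightarrow> 'g set \<Rightarrow> 'x \<Rightarrow> real" where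
  "orbit_sum act \<Phi> A x = (\<Sum>g\<in>A. \<Phi> (act g x))"

(* The critical value of a family m of outer quantities m s that jumps from infinity to 0 as s grows;
   the infimum of the empty set is infinity. *)
definition critical_value :: "(real \<Rightarrow> ennreal) \<Rightarrow> ennreal" where
  "critical_value m = Inf (ennreal ` {s. s > 0 \<and> m s = 0})"

(* A finite or countable family of Bowen balls is coded as a triple (I, n, x) with an arbitrary
   index set I of naturals; the values of n and x outside I are irrelevant. *)
definition ball_families ::
  "nat \<Rightarrow> (nat set \<times> (nat \<Rightarrow> nat) \<times> (nat \<Rightarrow> 'x)) set" where
  "ball_families N = {(I, n, x). \<forall>i\<in>I. N \<le> n i}"

definition family_union ::
  "('g \<Rightarrow> 'x::metric_space \<Rightarrow> 'x) \<Rightarrow> (nat \<Rightarrow> 'g set) \<Rightarrow> real \<Rightarrow>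
   nat set \<times> (nat \<Rightarrow> nat) \<times> (nat \<Rightarrow> 'x) \<Rightarrow> 'x set" where
  "family_union act F \<epsilon> = (\<lambda>(I, n, x). \<Union>i\<in>I. bowen_ball act (F (n i)) (x i) \<epsilon>)"

definition family_cost_sup ::
  "('g \<Rightarrow> 'x::metric_space \<Rightarrow> 'x) \<Rightarrow> (nat \<Rightarrow> 'g set) \<Rightarrow> ('x \<Rightarrow> real) \<Rightarrow> real \<Rightarrow> real \<Rightarrow>
   nat set \<times> (nat \<Rightarrow> nat) \<times> (nat \<Rightarrow> 'x) \<Rightarrow> ennreal" where
  "family_cost_sup act F \<Phi> \<epsilon> s = (\<lambda>(I, n, x).
     \<Sum>\<^sub>\<infinity>i\<in>I. ennreal (exp (- s *
       (SUP y\<in>bowen_ball act (F (n i)) (x i) \<epsilon>. orbit_sum act \<Phi> (F (n i)) y))))"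

definition family_cost ::
  "('g \<Rightarrow> 'x::metric_space \<Rightarrow> 'x) \<Rightarrow> (nat \<Rightarrow> 'g set) \<Rightarrow> ('x \<Rightarrow> real) \<Rightarrow> real \<Rightarrow>
   nat set \<times> (nat \<Rightarrow> nat) \<times> (nat \<Rightarrow> 'x) \<Rightarrow> ennreal" where
  "family_cost act F \<Phi> s = (\<lambda>(I, n, x).
     \<Sum>\<^sub>\<infinity>i\<in>I. ennreal (exp (- s * orbit_sum act \<Phi> (F (n i)) (x i))))"

(* All limits below are monotone, hence exist in ennreal, and Lim is the actual limit. *)

definition BS_crit ::
  "('g \<Rightarrow> 'x::metric_space \<Rightarrow> 'x) \<Rightarrow> (nat \<Rightarrow> 'g set) \<Rightarrow> ('x \<Rightarrow> real) \<Rightarrow> 'x set \<Rightarrow> real \<Rightarrow> ennreal"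
  where
  "BS_crit act F \<Phi> H \<epsilon> = critical_value (\<lambda>s.
     lim (\<lambda>N. INF c\<in>{c \<in> ball_families N. H \<subseteq> family_union act F \<epsilon> c}.
       family_cost_sup act F \<Phi> \<epsilon> s c))"

definition BS_dim ::
  "('g \<Rightarrow> 'x::metric_space \<Rightarrow> 'x) \<Rightarrow> (nat \<Rightarrow> 'g set) \<Rightarrow> ('x \<Rightarrow> real) \<Rightarrow> 'x set \<Rightarrow> ennreal" where
  "BS_dim act F \<Phi> H = Lim (at_right 0) (\<lambda>\<epsilon>. BS_crit act F \<Phi> H \<epsilon>)"

definition BS_crit_centre ::
  "('g \<Rightarrow> 'x::metric_space \<Rightarrow> 'x) \<Rightarrow> (nat \<Rightarrow> 'g set) \<Rightarrow> ('x \<Rightarrow> real) \<Rightarrow> 'x set \<Rightarrow> real \<Rightarrow> ennreal"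
  where
  "BS_crit_centre act F \<Phi> H \<epsilon> = critical_value (\<lambda>s.
     lim (\<lambda>N. INF c\<in>{c \<in> ball_families N. H \<subseteq> family_union act F \<epsilon> c}.
       family_cost act F \<Phi> s c))"

definition BS_dim_measure ::
  "('g \<Rightarrow> 'x::metric_space \<Rightarrow> 'x) \<Rightarrow> (nat \<Rightarrow> 'g set) \<Rightarrow> ('x \<Rightarrow> real) \<Rightarrow> 'x measure \<Rightarrow> ennreal"
  where
  "BS_dim_measure act F \<Phi> \<mu> =
     Lim (at_right 0) (\<lambda>\<epsilon>. Lim (at_right 0) (\<lambda>\<delta>::real.
       INF Z\<in>{Z \<in> sets borel. measure \<mu> Z \<ge> 1 - \<delta>}. BS_crit_centre act F \<Phi> Z \<epsilon>))"

definition Katok_crit ::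
  "('g \<Rightarrow> 'x::metric_space \<Rightarrow> 'x) \<Rightarrow> (nat \<Rightarrow> 'g set) \<Rightarrow> ('x \<Rightarrow> real) \<Rightarrow> 'x measure \<Rightarrow> real \<Rightarrow> real
   \<Rightarrow> ennreal" where
  "Katok_crit act F \<Phi> \<mu> \<epsilon> \<delta> = critical_value (\<lambda>s.
     lim (\<lambda>N. INF c\<in>{c \<in> ball_families N. measure \<mu> (family_union act F \<epsilon> c) > 1 - \<delta>}.
       family_cost act F \<Phi> s c))"

definition Katok_dim_measure ::
  "('g \<Rightarrow> 'x::metric_space \<Rightarrow> 'x) \<Rightarrow> (nat \<Rightarrow> 'g set) \<Rightarrow> ('x \<Rightarrow> real) \<Rightarrow> 'x measure \<Rightarrow> ennreal"
  where
  "Katok_dim_measure act F \<Phi> \<mu> =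
     Lim (at_right 0) (\<lambda>\<epsilon>. Lim (at_right 0) (\<lambda>\<delta>. Katok_crit act F \<Phi> \<mu> \<epsilon> \<delta>))"

(* -log p for p in [0,1], with -log 0 = infinity (the library has ln 0 = 0 on the reals). *)
definition neg_log :: "real \<Rightarrow> ennreal" where
  "neg_log p = (if p = 0 then \<infinity> else ennreal (- ln p))"

definition lower_BK ::
  "('g \<Rightarrow> 'x::metric_space \<Rightarrow> 'x) \<Rightarrow> (nat \<Rightarrow> 'g set) \<Rightarrow> ('x \<Rightarrow> real) \<Rightarrow> 'x measure \<Rightarrow> ennreal"
  where
  "lower_BK act F \<Phi> \<mu> =
     (\<integral>\<^sup>+x. Lim (at_right 0) (\<lambda>\<epsilon>.
        liminf (\<lambda>n. neg_log (measure \<mu> (bowen_ball act (F n) x \<epsilon>)) /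
                     ennreal (orbit_sum act \<Phi> (F n) x))) \<partial>\<mu>)"

end

theory Submission
  imports Defs
begin

text \<open>For every \<open>\<mu>\<close> with \<open>\<mu> H = 1\<close> the four quantities satisfy
\<open>lower_BK \<mu> \<le> Katok_dim_measure \<mu> \<le> BS_dim_measure \<mu> \<le> BS_dim H\<close>, so it suffices to find, for every \<open>s < BS_dim H\<close>,
a measure on \<open>H\<close> whose lower local dimension is at least \<open>s\<close> everywhere.

The chain is soft. A positive continuous \<open>\<Phi>\<close> on a compact space varies by a factor close to one on small
balls, so orbit sums over the same Bowen ball agree up to a factor \<open>1 + \<eta>\<close>, uniformly in the level
(\<open>orbit_sum_variation\<close>). Costs with suprema and costs at centres therefore have the same critical values in the limit
(\<open>BS_dim_measure_le_BS_dim\<close>), and the usual mass distribution argument bounds the local dimension by the Katok dimension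
(\<open>lower_BK_le_Katok_dim_measure\<close>).

The measure is found by duality (\<open>frostman_measure\<close>). Measures on \<open>H\<close> with
\<open>\<mu> (B n x \<epsilon>) \<le> C * exp (- s * S n x)\<close> are dual to weighted covers of \<open>H\<close> by Bowen balls, and weighted covers
are no cheaper than honest covers, up to doubling the radius and a small change of the exponent
(\<open>cover_of_weighted_cover\<close>). In place of the Hahn-Banach and Riesz theorems, duality is carried out among
finitely additive probabilities on all subsets. They form a compact set by Tychonoff's theorem, on which a
quadratic penalty for the violated constraints attains its minimum; the first-order condition at the minimiser is a
weighted cover (\<open>finadd_probs_finite_constraints\<close>). A finitely additive probability is then turned into a Borel measure that does
not exceed it on open sets and keeps its mass on \<open>H\<close> (\<open>finadd_probs_regularise\<close>).\<close>

section \<open>Limits, critical values and sums\<close>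

lemma lim_incseq_ennreal: "incseq f \<Longrightarrow> lim f = (SUP n. f n :: ennreal)"
  by (intro limI LIMSEQ_SUP)

text \<open>Every quantity behind the dimensions is monotone in its scale, so each limit \<open>\<epsilon> \<rightarrow> 0\<close> or
\<open>\<delta> \<rightarrow> 0\<close> may be read as a supremum over the positive scales.\<close>

lemma Lim_at_right_antimono:
  fixes f :: "real \<Rightarrow> ennreal"
  assumes anti: "\<And>x y. 0 < x \<Longrightarrow> x \<le> y \<Longrightarrow> f y \<le> f x"
  shows "Lim (at_right 0) f = (SUP x\<in>{0<..}. f x)"
proof (rule tendsto_Lim)
  show "(f \<longlongrightarrow> (SUP x\<in>{0<..}. f x)) (at_right 0)"
  proof (rule order_tendstoI)
    fix a assume "a < (SUP x\<in>{0<..}. f x)"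
    then obtain x where x: "x > 0" "a < f x"
      by (auto simp: less_SUP_iff)
    have "eventually (\<lambda>y. y \<in> {0<..<x}) (at_right 0)"
      using x(1) by (rule eventually_at_right_less[THEN eventually_mono, rotated] | auto simp: eventually_at_right_field)+
    then show "\<forall>\<^sub>F y in at_right 0. a < f y"
      by eventually_elim (use anti x in \<open>auto intro: less_le_trans less_imp_le\<close>)
  next
    fix a assume a: "(SUP x\<in>{0<..}. f x) < a"
    have "eventually (\<lambda>y. y > (0::real)) (at_right 0)"
      by (simp add: eventually_at_right_less)
    then show "\<forall>\<^sub>F y in at_right 0. f y < a"
      by eventually_elim (use SUP_lessD[OF a] in auto)
  qed
qed simp

lemma critical_value_mono:
  assumes "\<And>s. s > 0 \<Longrightarrow> m s \<le> m' s"
  shows "critical_value m \<le> critical_value m'"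
  unfolding critical_value_def
  by (rule Inf_superset_mono) (use assms in \<open>fastforce simp: order_antisym_conv\<close>)

text \<open>This is how a bounded multiplicative error in the exponents becomes the same factor in the
critical value.\<close>

lemma critical_value_scale:
  assumes c: "c > 0" and le: "\<And>s. s > 0 \<Longrightarrow> m (c * s) \<le> m' s"
  shows "critical_value m \<le> ennreal c * critical_value m'"
proof -
  have "ennreal (1 / c) * critical_value m \<le> critical_value m'"
    unfolding critical_value_def[of m']
  proof (rule INF_greatest)
    fix s assume "s \<in> {s. s > 0 \<and> m' s = 0}"
    with le[of s] c have "c * s > 0" "m (c * s) = 0" by auto
    then have "critical_value m \<le> ennreal (c * s)"
      unfolding critical_value_def by (intro Inf_lower) auto
    then have "ennreal (1 / c) * critical_value m \<le> ennreal (1 / c) * ennreal (c * s)"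
      by (rule mult_left_mono) simp
    then show "ennreal (1 / c) * critical_value m \<le> ennreal s"
      using c by (simp flip: ennreal_mult')
  qed
  then have "ennreal c * (ennreal (1 / c) * critical_value m) \<le> ennreal c * critical_value m'"
    by (rule mult_left_mono) simp
  then show ?thesis
    using c by (simp add: mult.assoc[symmetric] flip: ennreal_mult')
qed

lemma critical_value_ge:
  assumes anti: "\<And>s s'. 0 < s \<Longrightarrow> s \<le> s' \<Longrightarrow> m s' \<le> m s" and t: "t > 0" "m t \<noteq> 0"
  shows "ennreal t \<le> critical_value m"
  unfolding critical_value_def
proof (rule INF_greatest)
  fix s assume "s \<in> {s. s > 0 \<and> m s = 0}"
  with anti[of s t] t have "\<not> s \<le> t" by auto
  then show "ennreal t \<le> ennreal s" by (simp add: ennreal_leI)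
qed

lemma below_critical_value:
  assumes "0 < s" "ennreal s < critical_value m"
  shows "m s \<noteq> 0"
proof
  assume "m s = 0"
  then have "critical_value m \<le> ennreal s"
    unfolding critical_value_def using assms by (intro Inf_lower) auto
  with assms show False by simp
qed

lemma infsum_ennreal_mono:
  fixes f g :: "'i \<Rightarrow> ennreal"
  assumes "\<And>i. i \<in> I \<Longrightarrow> f i \<le> g i"
  shows "infsum f I \<le> infsum g I"
  by (intro infsum_mono nonneg_summable_on_complete) (auto simp: assms)

lemma infsum_nat_ennreal:
  fixes f :: "nat \<Rightarrow> ennreal"
  shows "infsum f I = (\<Sum>i. if i \<in> I then f i else 0)"
proof -
  have "infsum f I = infsum (\<lambda>i. if i \<in> I then f i else 0) UNIV"
    by (rule infsum_cong_neutral) auto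
  also have "\<dots> = (\<Sum>i. if i \<in> I then f i else 0)"
    by (intro sums_unique has_sum_imp_sums has_sum_infsum nonneg_summable_on_complete) auto
  finally show ?thesis .
qed

text \<open>All comparisons below hold up to a factor \<open>1 + \<eta>\<close>, which is removed here.\<close>

lemma ennreal_le_by_factor:
  fixes a b :: ennreal
  assumes "\<And>\<eta>::real. \<eta> > 0 \<Longrightarrow> a \<le> ennreal (1 + \<eta>) * b"
  shows "a \<le> b"
proof (cases "b = \<infinity>")
  case False
  have lim: "((\<lambda>\<eta>. ennreal (1 + \<eta>) * b) \<longlongrightarrow> ennreal (1 + 0) * b) (at_right 0)"
    using False by (intro tendsto_mult_ennreal tendsto_intros) (auto simp: infinity_ennreal_def)
  have "eventually (\<lambda>\<eta>. \<eta> > (0::real)) (at_right 0)"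
    by (simp add: eventually_at_right_less)
  then have "eventually (\<lambda>\<eta>. a \<le> ennreal (1 + \<eta>) * b) (at_right 0)"
    by eventually_elim (rule assms)
  from tendsto_lowerbound[OF lim this] show ?thesis by simp
qed simp

text \<open>Used to give level \<open>n\<close> of a weighted cover the threshold \<open>exp (- a * n)\<close>: a point that stays
below the threshold on every level \<open>n \<ge> N\<close> would have total weight less than one.\<close>

lemma exp_tail_sums_less_one:
  assumes "a > 0"
  shows "\<exists>N0. \<forall>N\<ge>N0. \<forall>K. finite K \<longrightarrow> K \<subseteq> {N..} \<longrightarrow> (\<Sum>n\<in>K. exp (- a * real n)) < 1"
proof -
  have "summable (\<lambda>n. exp (- a) ^ n)"
    using assms by (intro summable_geometric) simp
  then have "summable (\<lambda>n. exp (- a * real n))"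
    by (simp add: exp_of_nat_mult[symmetric] mult.commute)
  then obtain N0 where N0: "\<And>k n. k \<ge> N0 \<Longrightarrow> norm (\<Sum>i=k..<n. exp (- a * real i)) < 1"
    unfolding summable_Cauchy using zero_less_one by blast
  show ?thesis
  proof (intro exI allI impI)
    fix N K assume "N0 \<le> N" and K: "finite K" "K \<subseteq> {N..}"
    obtain k where "\<forall>n\<in>K. n < k" using finite_nat_set_iff_bounded K(1) by blast
    then have "(\<Sum>n\<in>K. exp (- a * real n)) \<le> (\<Sum>i=N..<k. exp (- a * real i))"
      using K by (intro sum_mono2) auto
    also have "\<dots> < 1" using N0[OF \<open>N0 \<le> N\<close>, of k] by simp
    finally show "(\<Sum>n\<in>K. exp (- a * real n)) < 1" .
  qed
qed

lemma less_neg_log_quotientD: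
  assumes "0 < s" "0 < a" "0 \<le> p" "p \<le> 1" "ennreal s < neg_log p / ennreal a"
  shows "p \<le> exp (- s * a)"
proof (cases "p = 0")
  case False
  then have p: "0 < p" using assms by simp
  then have "neg_log p / ennreal a = ennreal (- ln p / a)"
    using assms by (simp add: neg_log_def divide_ennreal)
  then have "s < - ln p / a" using assms by (simp add: ennreal_less_iff)
  then have "ln p \<le> - s * a" using pos_less_divide_eq[OF assms(2), of s "- ln p"] by simp
  then show ?thesis using p by (metis exp_le_cancel_iff exp_ln)
qed simp

lemma neg_log_antimono: "0 \<le> p \<Longrightarrow> p \<le> q \<Longrightarrow> neg_log q \<le> neg_log p"
  by (auto simp: neg_log_def intro!: ennreal_leI)

lemma neg_log_quotient_ge:
  assumes "0 < a" "0 < C" "0 \<le> p" "p \<le> 1" "p \<le> C * exp (- s * a)"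
  shows "ennreal (s - ln C / a) \<le> neg_log p / ennreal a"
proof (cases "p = 0")
  case True
  then show ?thesis using assms by (simp add: neg_log_def ennreal_divide_eq_top_iff ennreal_top_divide)
next
  case False
  then have p: "p > 0" using assms by simp
  then have "ln p \<le> ln (C * exp (- s * a))" using assms by simp
  also have "\<dots> = ln C - s * a" using assms by (simp add: ln_mult)
  finally have "(s * a - ln C) / a \<le> - ln p / a" using assms by (intro divide_right_mono) auto
  then have "s - ln C / a \<le> - ln p / a" using assms by (simp add: diff_divide_distrib)
  then show ?thesis
    using p assms by (simp add: neg_log_def divide_ennreal ennreal_leI)
qed

section \<open>Finitely additive probabilities with prescribed upper bounds\<close>

text \<open>All subsets are measured, so such an \<open>m\<close> is a point of the cube \<open>[0,1]\<close> to the power of the set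
of all subsets, and compactness comes from Tychonoff's theorem with no reference to a topology on
the underlying set.\<close>

definition finadd_probs :: "'a set \<Rightarrow> ('a set \<Rightarrow> real) set" where
  "finadd_probs H = {m. (\<forall>A. 0 \<le> m A) \<and> (\<forall>A B. A \<inter> B = {} \<longrightarrow> m (A \<union> B) = m A + m B)
     \<and> m H = 1 \<and> m (- H) = 0}"

lemma finadd_probs_Un: "m \<in> finadd_probs H \<Longrightarrow> A \<inter> B = {} \<Longrightarrow> m (A \<union> B) = m A + m B"
  unfolding finadd_probs_def by blast

lemma finadd_probs_nonneg: "m \<in> finadd_probs H \<Longrightarrow> 0 \<le> m A"
  unfolding finadd_probs_def by blast

lemma finadd_probs_empty: "m \<in> finadd_probs H \<Longrightarrow> m {} = 0"
  using finadd_probs_Un[of m H "{}" "{}"] by simp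

lemma finadd_probs_mono:
  assumes "m \<in> finadd_probs H" "A \<subseteq> B"
  shows "m A \<le> m B"
proof -
  have "m (A \<union> (B - A)) = m A + m (B - A)"
    using assms(1) by (rule finadd_probs_Un) simp
  with assms(2) finadd_probs_nonneg[OF assms(1), of "B - A"] show ?thesis by (simp add: Un_absorb1)
qed

lemma finadd_probs_UNIV:
  assumes "m \<in> finadd_probs H"
  shows "m UNIV = 1"
proof -
  have "m (H \<union> - H) = m H + m (- H)"
    using assms by (rule finadd_probs_Un) simp
  with assms show ?thesis by (simp add: finadd_probs_def)
qed

lemma finadd_probs_le_1: "m \<in> finadd_probs H \<Longrightarrow> m A \<le> 1"
  using finadd_probs_mono[of m H A UNIV] finadd_probs_UNIV[of m H] by simp

lemma finadd_probs_Un_le: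
  assumes "m \<in> finadd_probs H"
  shows "m (A \<union> B) \<le> m A + m B"
proof -
  have "m (A \<union> (B - A)) = m A + m (B - A)"
    using assms by (rule finadd_probs_Un) simp
  with finadd_probs_mono[OF assms, of "B - A" B] show ?thesis by simp
qed

lemma finadd_probs_UN_le:
  assumes "m \<in> finadd_probs H" "finite I"
  shows "m (\<Union>i\<in>I. A i) \<le> (\<Sum>i\<in>I. m (A i))"
  using assms(2)
proof induction
  case (insert i I)
  then show ?case
    using finadd_probs_Un_le[OF assms(1), of "A i" "\<Union>i\<in>I. A i"] by simp
qed (simp add: finadd_probs_empty[OF assms(1)])

lemma compact_finadd_probs: "compact (finadd_probs H)"
proof -
  have cont: "continuous_on UNIV (\<lambda>m. m A)" for A :: "'a set"
    by (rule continuous_on_product_coordinates)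
  have "finadd_probs H = (\<Inter>A. {m. 0 \<le> m A}) \<inter>
      (\<Inter>(A, B)\<in>{(A, B). A \<inter> B = {}}. {m. m (A \<union> B) = m A + m B}) \<inter> {m. m H = 1} \<inter> {m. m (- H) = 0}"
    unfolding finadd_probs_def by auto
  moreover have "closed \<dots>"
    by (intro closed_Int closed_INT ballI)
      (auto intro!: closed_Collect_le closed_Collect_eq closed_Collect_all closed_Collect_imp cont
        continuous_intros split: prod.splits)
  ultimately have "closed (finadd_probs H)" by simp
  moreover have "compact (PiE UNIV (\<lambda>_::'a set. {0..1::real}))"
  proof -
    have "compactin (product_topology (\<lambda>_. euclidean) UNIV) (PiE UNIV (\<lambda>_::'a set. {0..1::real}))"
      by (subst compactin_PiE) (simp add: compactin_euclidean_iff)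
    then show ?thesis by (simp only: euclidean_product_topology compactin_euclidean_iff)
  qed
  moreover have "finadd_probs H \<subseteq> PiE UNIV (\<lambda>_::'a set. {0..1::real})"
    using finadd_probs_le_1[of _ H] unfolding finadd_probs_def PiE_UNIV_domain by auto
  ultimately show ?thesis
    by (metis compact_Int_closed inf.absorb_iff2)
qed

lemma finadd_probs_mix:
  assumes "m \<in> finadd_probs H" "m' \<in> finadd_probs H" "0 \<le> t" "t \<le> (1::real)"
  shows "(\<lambda>A. (1 - t) * m A + t * m' A) \<in> finadd_probs H"
proof -
  have "0 \<le> (1 - t) * m A + t * m' A" for A
    using assms by (auto intro!: add_nonneg_nonneg mult_nonneg_nonneg simp: finadd_probs_def)
  with assms show ?thesis
    unfolding finadd_probs_def by (simp add: distrib_left)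
qed

text \<open>Linear programming duality for finitely many constraints \<open>m (B j) \<le> w j\<close>, in a form that needs no
separation theorem. Let \<open>m\<close> minimise the total squared excess \<open>g\<close> on the compact set of all finitely
additive probabilities on \<open>H\<close>, and let \<open>c j\<close> be the excess of \<open>m\<close> at \<open>j\<close>. Moving mass from \<open>m\<close> towards
a point \<open>x\<close> of \<open>H\<close> cannot decrease \<open>g\<close>, and the first-order condition says that the function
\<open>\<Sum>j. c j * indicator (B j)\<close> is at least \<open>S = \<Sum>j. c j * m (B j)\<close> at every \<open>x \<in> H\<close>. If some excess were
positive, then \<open>c j / S\<close> would be a weighted cover of \<open>H\<close> of cost less than one.\<close>

lemma finadd_probs_finite_constraints:
  assumes J: "finite J" and H: "H \<noteq> {}" and w: "\<And>j. j \<in> J \<Longrightarrow> 0 \<le> w j"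
    and weighted: "\<And>c. (\<And>j. j \<in> J \<Longrightarrow> 0 \<le> c j) \<Longrightarrow>
      (\<And>x. x \<in> H \<Longrightarrow> 1 \<le> (\<Sum>j\<in>J. c j * indicator (B j) x)) \<Longrightarrow> 1 \<le> (\<Sum>j\<in>J. c j * w j :: real)"
  shows "\<exists>m\<in>finadd_probs H. \<forall>j\<in>J. m (B j) \<le> w j"
proof -
  define g where "g m = (\<Sum>j\<in>J. (max 0 (m (B j) - w j))\<^sup>2)" for m
  obtain x0 where x0: "x0 \<in> H" using H by blast
  have dirac: "(\<lambda>A. indicator A x) \<in> finadd_probs H" if "x \<in> H" for x
    using that unfolding finadd_probs_def by (auto simp: indicator_def)
  have "continuous_on UNIV g"
    unfolding g_def
    by (intro continuous_intros continuous_on_max continuous_on_product_coordinates)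
  then obtain m where m: "m \<in> finadd_probs H" and min: "\<And>m'. m' \<in> finadd_probs H \<Longrightarrow> g m \<le> g m'"
    using continuous_attains_inf[OF compact_finadd_probs, of H g] dirac[OF x0]
    by (metis continuous_on_subset empty_iff subset_UNIV)
  define c where "c j = max 0 (m (B j) - w j)" for j
  have c0: "0 \<le> c j" for j by (simp add: c_def)
  have g_m: "g m = (\<Sum>j\<in>J. (c j)\<^sup>2)" by (simp add: g_def c_def)
  have first_order: "(\<Sum>j\<in>J. c j * m (B j)) \<le> (\<Sum>j\<in>J. c j * indicator (B j) x)" if x: "x \<in> H" for x
  proof -
    define d where "d j = indicator (B j) x - m (B j)" for j
    define P where "P = (\<Sum>j\<in>J. c j * d j)"
    define Q where "Q = (\<Sum>j\<in>J. (d j)\<^sup>2)"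
    have "0 \<le> 2 * P + t * Q" if t: "0 < t" "t \<le> 1" for t
    proof -
      have "g m \<le> g (\<lambda>A. (1 - t) * m A + t * indicator A x)"
        using t by (intro min finadd_probs_mix m dirac x) auto
      also have "\<dots> \<le> (\<Sum>j\<in>J. (c j + t * d j)\<^sup>2)"
        unfolding g_def
      proof (rule sum_mono)
        fix j
        let ?a = "m (B j) - w j"
        have eq: "(1 - t) * m (B j) + t * indicator (B j) x - w j = ?a + t * d j"
          by (simp add: d_def algebra_simps)
        \<comment> \<open>The squared positive part is bounded by a polynomial in \<open>t\<close> that agrees with it at \<open>t = 0\<close>.\<close>
        have "\<bar>max 0 (?a + t * d j)\<bar> \<le> \<bar>c j + t * d j\<bar>"
          unfolding c_def by linarith
        then show "(max 0 ((1 - t) * m (B j) + t * indicator (B j) x - w j))\<^sup>2 \<le> (c j + t * d j)\<^sup>2"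
          unfolding eq abs_le_square_iff .
      qed
      also have "\<dots> = g m + t * (2 * P + t * Q)"
        unfolding g_m P_def Q_def
        by (simp add: power2_eq_square algebra_simps sum.distrib sum_distrib_left)
      finally show ?thesis using t by (simp add: zero_le_mult_iff)
    qed
    note * = this
    have "((\<lambda>t. 2 * P + t * Q) \<longlongrightarrow> 2 * P + 0 * Q) (at_right 0)"
      by (intro tendsto_intros)
    moreover have "eventually (\<lambda>t. 0 \<le> 2 * P + t * Q) (at_right 0)"
      unfolding eventually_at_right_field using * by (intro exI[of _ 1]) auto
    ultimately have "0 \<le> 2 * P + 0 * Q"
      by (rule tendsto_lowerbound) simp
    then show ?thesis
      by (simp add: P_def d_def algebra_simps sum_subtractf)
  qed
  have "\<forall>j\<in>J. c j = 0"
  proof (rule ccontr)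
    assume "\<not> (\<forall>j\<in>J. c j = 0)"
    then have pos: "(\<Sum>j\<in>J. (c j)\<^sup>2) > 0"
      using J by (metis (mono_tags, lifting) less_eq_real_def power_eq_0_iff sum_nonneg_eq_0_iff sum_nonneg zero_le_power2)
    define S where "S = (\<Sum>j\<in>J. c j * m (B j))"
    have "c j * m (B j) = c j * w j + (c j)\<^sup>2" for j
      by (cases "m (B j) \<le> w j") (auto simp: c_def power2_eq_square algebra_simps)
    then have S: "S = (\<Sum>j\<in>J. c j * w j) + (\<Sum>j\<in>J. (c j)\<^sup>2)"
      by (simp add: S_def sum.distrib)
    have "0 \<le> (\<Sum>j\<in>J. c j * w j)" by (intro sum_nonneg mult_nonneg_nonneg c0 w)
    with S pos have S0: "S > 0" by simp
    have "1 \<le> (\<Sum>j\<in>J. c j / S * w j)"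
    proof (rule weighted)
      fix x assume "x \<in> H"
      from first_order[OF this] S0 show "1 \<le> (\<Sum>j\<in>J. c j / S * indicator (B j) x)"
        by (simp add: S_def[symmetric] sum_divide_distrib[symmetric])
    qed (use S0 c0 in auto)
    moreover have "(\<Sum>j\<in>J. c j / S * w j) = (\<Sum>j\<in>J. c j * w j) / S"
      by (simp add: sum_divide_distrib)
    ultimately have "S \<le> (\<Sum>j\<in>J. c j * w j)"
      using S0 by (simp add: flip: sum_divide_distrib times_divide_eq_left)
    with S pos show False by simp
  qed
  then have "\<forall>j\<in>J. m (B j) \<le> w j" by (auto simp: c_def max_def split: if_splits)
  with m show ?thesis by blast
qed

text \<open>Compactness passes from finitely many constraints to arbitrarily many.\<close>

lemma finadd_probs_constraints:
  assumes H: "H \<noteq> {}" and w: "\<And>j. j \<in> J \<Longrightarrow> 0 \<le> w j"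
    and weighted: "\<And>T c. finite T \<Longrightarrow> T \<subseteq> J \<Longrightarrow> (\<And>j. j \<in> T \<Longrightarrow> 0 \<le> c j) \<Longrightarrow>
      (\<And>x. x \<in> H \<Longrightarrow> 1 \<le> (\<Sum>j\<in>T. c j * indicator (B j) x)) \<Longrightarrow> 1 \<le> (\<Sum>j\<in>T. c j * w j :: real)"
  shows "\<exists>m\<in>finadd_probs H. \<forall>j\<in>J. m (B j) \<le> w j"
proof -
  have "finadd_probs H \<inter> (\<Inter>j\<in>J. {m. m (B j) \<le> w j}) \<noteq> {}"
  proof (rule compact_imp_fip_image[OF compact_finadd_probs])
    show "closed {m. m (B j) \<le> w j}" for j
      by (intro closed_Collect_le continuous_intros continuous_on_product_coordinates)
    fix T assume T: "finite T" "T \<subseteq> J"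
    have "\<exists>m\<in>finadd_probs H. \<forall>j\<in>T. m (B j) \<le> w j"
      using T H w weighted by (intro finadd_probs_finite_constraints) blast+
    then show "finadd_probs H \<inter> (\<Inter>j\<in>T. {m. m (B j) \<le> w j}) \<noteq> {}" by blast
  qed
  then show ?thesis by blast
qed

section \<open>From finitely additive probabilities to Borel measures\<close>

text \<open>The classical construction of a regular Borel measure from a content: inner approximation of
open sets by closed (hence compact) sets, then outer approximation of arbitrary sets by open ones.
The result lies below \<open>m\<close> on open sets, which is what upper bounds for balls need, and above \<open>m\<close> on
closed sets, which keeps the whole mass on \<open>H\<close>. Countable subadditivity on open sets is the step
where compactness replaces the missing countable additivity of \<open>m\<close>.\<close>

lemma finadd_probs_regularise:
  fixes H :: "'x::metric_space set"
  assumes cpt: "compact (UNIV :: 'x set)" and H: "closed H" and m: "m \<in> finadd_probs H"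
  shows "\<exists>\<mu>\<in>borel_probs. measure \<mu> H = 1 \<and> (\<forall>U. open U \<longrightarrow> measure \<mu> U \<le> m U)"
proof -
  define lam where "lam U = (SUP K\<in>{K. closed K \<and> K \<subseteq> U}. ennreal (m K))" for U
  define out where "out A = (INF U\<in>{U. open U \<and> A \<subseteq> U}. lam U)" for A
  note m0 = finadd_probs_nonneg[OF m] and m_mono = finadd_probs_mono[OF m]
  have lam_mono: "lam U \<le> lam V" if "U \<subseteq> V" for U V
    unfolding lam_def using that by (intro SUP_subset_mono) auto
  have lam_ge: "ennreal (m K) \<le> lam U" if "closed K" "K \<subseteq> U" for K U
    unfolding lam_def using that by (intro SUP_upper) auto
  have lam_le: "lam U \<le> ennreal (m U)" for U
    unfolding lam_def by (intro SUP_least ennreal_leI m_mono) auto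
  have out_le: "out A \<le> lam U" if "open U" "A \<subseteq> U" for A U
    unfolding out_def using that by (intro INF_lower) auto
  have out_open: "out U = lam U" if "open U" for U
    unfolding out_def using that by (intro antisym INF_lower INF_greatest lam_mono) auto
  have out_mono: "out A \<le> out B" if "A \<subseteq> B" for A B
    unfolding out_def using that by (intro INF_superset_mono) auto
  have out_empty: "out {} = 0"
    using out_le[of "{}" "{}"] lam_le[of "{}"] by (simp add: finadd_probs_empty[OF m])
  have lam_UN: "lam (\<Union>i. U i) \<le> (\<Sum>i. lam (U i))" if U: "\<And>i::nat. open (U i)" for U
    unfolding lam_def[of "\<Union>i. U i"]
  proof (intro SUP_least)
    fix K assume "K \<in> {K. closed K \<and> K \<subseteq> (\<Union>i. U i)}"
    then have K: "compact K" "K \<subseteq> (\<Union>i. U i)"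
      using compact_Int_closed[OF cpt] by auto
    have "\<forall>x\<in>K. \<exists>i. x \<in> U i" using K(2) by blast
    then obtain i where i: "\<forall>x\<in>K. x \<in> U (i x)" by (rule bchoice[THEN exE])
    have "\<forall>x\<in>K. \<exists>r>0. cball x r \<subseteq> U (i x)"
      using U i by (simp add: open_contains_cball)
    then have "\<forall>x\<in>K. \<exists>r. r > 0 \<and> cball x r \<subseteq> U (i x)" by blast
    then obtain r where ir: "\<forall>x\<in>K. r x > 0 \<and> cball x (r x) \<subseteq> U (i x)" by (rule bchoice[THEN exE])
    have "K \<subseteq> (\<Union>x\<in>K. ball x (r x))" using ir by force
    then obtain D where D: "D \<subseteq> K" "finite D" "K \<subseteq> (\<Union>x\<in>D. ball x (r x))"
      by (rule compactE_image[OF K(1), where C = K and f = "\<lambda>x. ball x (r x)", rotated]) auto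
    \<comment> \<open>The closed balls of a finite subcover, grouped by the open set that contains them.\<close>
    define L where "L k = (\<Union>x\<in>{x\<in>D. i x = k}. cball x (r x))" for k
    have L: "closed (L k)" "L k \<subseteq> U k" for k
      unfolding L_def using D ir by (auto intro!: closed_UN)
    have "K \<subseteq> (\<Union>k\<in>i`D. L k)"
      using D(3) by (force simp: L_def)
    then have "m K \<le> (\<Sum>k\<in>i`D. m (L k))"
      using m_mono finadd_probs_UN_le[OF m, of "i`D" L] D(2) by (meson finite_imageI order_trans)
    then have "ennreal (m K) \<le> (\<Sum>k\<in>i`D. ennreal (m (L k)))"
      by (simp add: sum_ennreal m0 ennreal_leI)
    also have "\<dots> \<le> (\<Sum>k\<in>i`D. lam (U k))"
      by (intro sum_mono lam_ge L)
    also have "\<dots> \<le> (\<Sum>k. lam (U k))"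
      using D(2) by (intro sum_le_suminf) auto
    finally show "ennreal (m K) \<le> (\<Sum>k. lam (U k))" .
  qed
  have approx: "\<exists>U. open U \<and> A \<subseteq> U \<and> lam U \<le> out A + ennreal e" if "e > 0" for A e
  proof -
    have "out A \<le> lam UNIV" by (rule out_le) auto
    also have "\<dots> \<le> ennreal (m UNIV)" by (rule lam_le)
    also have "\<dots> < \<top>" by simp
    finally have "out A < out A + ennreal e"
      using that by (cases "out A") (auto simp: ennreal_less_iff simp flip: ennreal_plus)
    then have "Inf (lam ` {U. open U \<and> A \<subseteq> U}) < out A + ennreal e"
      by (simp only: out_def[symmetric])
    then obtain U where "open U" "A \<subseteq> U" "lam U < out A + ennreal e"
      unfolding INF_less_iff by blast
    then show ?thesis by (blast intro: less_imp_le)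
  qed
  have oms: "outer_measure_space UNIV out"
    unfolding outer_measure_space_def positive_def increasing_def countably_subadditive_def
  proof (intro conjI ballI allI impI)
    fix A :: "nat \<Rightarrow> 'x set"
    show "out (\<Union>i. A i) \<le> (\<Sum>i. out (A i))"
    proof (rule ennreal_le_epsilon)
      fix e :: real assume e: "e > 0"
      have "\<exists>U. open U \<and> A i \<subseteq> U \<and> lam U \<le> out (A i) + ennreal (e * (1/2)^Suc i)" for i
        using e by (intro approx) simp
      then obtain U where U: "\<And>i. open (U i)" "\<And>i. A i \<subseteq> U i"
        "\<And>i. lam (U i) \<le> out (A i) + ennreal (e * (1/2)^Suc i)" by metis
      have "out (\<Union>i. A i) \<le> lam (\<Union>i. U i)" using U by (intro out_le) auto
      also have "\<dots> \<le> (\<Sum>i. lam (U i))" by (rule lam_UN[OF U(1)])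
      also have "\<dots> \<le> (\<Sum>i. out (A i) + ennreal (e * (1/2)^Suc i))"
        by (intro suminf_le U) auto
      also have "\<dots> = (\<Sum>i. out (A i)) + (\<Sum>i. ennreal (e * (1/2)^Suc i))"
        by (intro suminf_add[symmetric]) auto
      also have "(\<Sum>i. ennreal (e * (1/2)^Suc i)) = ennreal e"
        using e sums_mult[OF power_half_series, of e] by (intro suminf_ennreal_eq) auto
      finally show "out (\<Union>i. A i) \<le> (\<Sum>i. out (A i)) + ennreal e" .
    qed
  qed (auto simp: out_empty out_mono)
  interpret alg: sigma_algebra "UNIV :: 'x set" UNIV
    using sigma_algebra_Pow[of "UNIV :: 'x set"] by simp
  define L where "L = lambda_system UNIV UNIV out"
  have ms: "measure_space UNIV L out"
    unfolding L_def by (rule alg.caratheodory_lemma[OF oms])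
  have open_L: "U \<in> L" if U: "open U" for U
  proof -
    \<comment> \<open>Inside an almost optimal open \<open>V \<supseteq> A\<close>, exhaust \<open>V \<inter> U\<close> by a closed \<open>K\<close> and then \<open>V - K\<close> by a disjoint closed \<open>K'\<close>.\<close>
    have "out (A \<inter> U) + out (A - U) \<le> out A" for A
    proof (rule ennreal_le_epsilon)
      fix e :: real assume e: "e > 0"
      obtain V where V: "open V" "A \<subseteq> V" "lam V \<le> out A + ennreal e"
        using approx[OF e] by blast
      have "out (A \<inter> U) + out (A - U) \<le> lam V"
      proof -
        have "ennreal (m K) + out (A - U) \<le> lam V" if K: "closed K" "K \<subseteq> V \<inter> U" for K
        proof -
          have "out (A - U) \<le> lam (V - K)"
            using V K by (intro out_le) auto
          moreover have "ennreal (m K) + lam (V - K) \<le> lam V"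
          proof -
            have "ennreal (m K) + ennreal (m K') \<le> lam V" if K': "closed K'" "K' \<subseteq> V - K" for K'
            proof -
              have "ennreal (m K) + ennreal (m K') = ennreal (m (K \<union> K'))"
                using K' by (subst finadd_probs_Un[OF m]) (auto simp: m0)
              also have "\<dots> \<le> lam V" using K K' by (intro lam_ge) auto
              finally show ?thesis .
            qed
            then show ?thesis
              unfolding lam_def[of "V - K"]
              by (subst ennreal_SUP_add_right) (auto intro!: SUP_least)
          qed
          ultimately show ?thesis by (metis add_left_mono order_trans)
        qed
        then have "lam (V \<inter> U) + out (A - U) \<le> lam V"
          unfolding lam_def[of "V \<inter> U"]
          by (subst ennreal_SUP_add_left[symmetric]) (auto intro!: SUP_least)
        moreover have "out (A \<inter> U) \<le> lam (V \<inter> U)"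
          using V U by (intro out_le) auto
        ultimately show ?thesis by (metis add_right_mono order_trans)
      qed
      with V(3) show "out (A \<inter> U) + out (A - U) \<le> out A + ennreal e" by simp
    qed
    moreover have "out A \<le> out (A \<inter> U) + out (A - U)" for A
    proof -
      have "subadditive UNIV out"
        using oms alg.countably_subadditive_subadditive unfolding outer_measure_space_def by blast
      then have "out ((A \<inter> U) \<union> (A - U)) \<le> out (A \<inter> U) + out (A - U)"
        unfolding subadditive_def by (metis Diff_disjoint Int_assoc UNIV_I inf_bot_right Int_Diff)
      then show ?thesis by (simp add: Int_Diff_Un)
    qed
    ultimately show ?thesis
      unfolding L_def alg.lambda_system_eq by (auto intro: antisym)
  qed
  have "sigma_algebra UNIV L" using ms by (simp add: measure_space_def)
  then have borel_L: "sets borel \<subseteq> L"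
    unfolding borel_def using open_L
    using sigma_algebra.sigma_sets_subset[of UNIV L "Collect open"] by auto
  define \<mu> where "\<mu> = measure_of UNIV (sets borel) out"
  have ms': "measure_space UNIV (sets borel) out"
    using measure_down[OF ms] borel_L sets.sigma_algebra_axioms[of borel] by simp
  have sets: "sets \<mu> = sets borel" and space: "space \<mu> = UNIV"
    unfolding \<mu>_def using sets.sigma_sets_eq[of "borel :: 'x measure"] by (auto simp: space_measure_of_conv)
  have emeasure: "emeasure \<mu> A = out A" if "A \<in> sets borel" for A
    unfolding \<mu>_def
    using that ms' by (intro emeasure_measure_of_sigma) (auto simp: measure_space_def)
  have out_H: "out H = 1" and out_UNIV: "out UNIV = 1"
  proof -
    have "1 \<le> out H"
      unfolding out_def using lam_ge[of H] H m by (intro INF_greatest) (auto simp: finadd_probs_def)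
    moreover have "out UNIV \<le> 1"
      using lam_le[of UNIV] by (simp add: out_open finadd_probs_UNIV[OF m])
    ultimately show "out H = 1" "out UNIV = 1"
      using out_mono[of H UNIV] by (auto intro: antisym order_trans)
  qed
  have "prob_space \<mu>"
    by (rule prob_spaceI) (simp add: space emeasure out_UNIV)
  moreover have "measure \<mu> H = 1"
    using H by (simp add: measure_def emeasure out_H)
  moreover have "measure \<mu> U \<le> m U" if "open U" for U
    using that lam_le[of U] by (simp add: measure_def emeasure out_open enn2real_leI m0)
  ultimately show ?thesis
    using sets by (auto simp: borel_probs_def)
qed

section \<open>Bowen balls and orbit sums\<close>

text \<open>The covering argument on a single level, where all balls have the same radius with respect to one
metric \<open>D\<close>. Take a largest family \<open>E\<close> of points of \<open>Z\<close> whose neighbourhoods \<open>N z\<close> in \<open>T\<close> are disjoint.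
By maximality the balls of radius \<open>2 * \<epsilon>\<close> about \<open>E\<close> cover \<open>Z\<close>, and by disjointness every \<open>z \<in> E\<close> can be
charged to the weight of \<open>N z\<close>, which exceeds \<open>t\<close>.\<close>

lemma separated_packing:
  fixes D :: "'x \<Rightarrow> 'x \<Rightarrow> real" and c u v :: "'x \<Rightarrow> real"
  assumes sym: "\<And>x y. D x y = D y x" and tri: "\<And>x y z. D x z \<le> D x y + D y z"
    and self: "\<And>x. D x x = 0" and \<epsilon>: "\<epsilon> > 0"
    and T: "finite T" and c: "\<And>x. x \<in> T \<Longrightarrow> 0 \<le> c x" and v: "\<And>x. x \<in> T \<Longrightarrow> 0 \<le> v x" and t: "t > 0"
    and heavy: "\<And>z. z \<in> Z \<Longrightarrow> t < (\<Sum>x\<in>{x\<in>T. D z x < \<epsilon>}. c x)"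
    and uv: "\<And>z x. z \<in> Z \<Longrightarrow> x \<in> T \<Longrightarrow> D z x < \<epsilon> \<Longrightarrow> u z \<le> v x"
  shows "\<exists>E. finite E \<and> E \<subseteq> Z \<and> (\<forall>y\<in>Z. \<exists>z\<in>E. D z y < 2 * \<epsilon>) \<and> t * (\<Sum>z\<in>E. u z) \<le> (\<Sum>x\<in>T. c x * v x)"
proof -
  define N where "N z = {x\<in>T. D z x < \<epsilon>}" for z
  define P where "P E \<longleftrightarrow> finite E \<and> E \<subseteq> Z \<and> (\<forall>z\<in>E. \<forall>z'\<in>E. z \<noteq> z' \<longrightarrow> N z \<inter> N z' = {})" for E
  have N: "finite (N z)" "N z \<subseteq> T" for z unfolding N_def using T by auto
  have N_ne: "N z \<noteq> {}" if "z \<in> Z" for z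
    using heavy[OF that] t unfolding N_def by (metis less_asym sum.empty)
  have "card E \<le> card T" if E: "P E" for E
  proof -
    have "card E \<le> (\<Sum>z\<in>E. card (N z))"
    proof -
      have "1 \<le> card (N z)" if "z \<in> E" for z
        using N(1)[of z] N_ne[of z] that E by (auto simp: P_def Suc_le_eq card_gt_0_iff)
      then show ?thesis using sum_mono[of E "\<lambda>_. 1" "\<lambda>z. card (N z)"] by simp
    qed
    also have "\<dots> = card (\<Union>z\<in>E. N z)"
      using E N by (intro card_UN_disjoint[symmetric]) (auto simp: P_def)
    also have "\<dots> \<le> card T"
      using N T by (intro card_mono) auto
    finally show ?thesis .
  qed
  moreover have "P {}" by (simp add: P_def)
  ultimately obtain E where E: "P E" and max: "\<And>E'. P E' \<Longrightarrow> card E' \<le> card E"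
    using ex_has_greatest_nat[of P "{}" card "Suc (card T)"] by (auto simp: less_Suc_eq_le)
  have cover: "\<exists>z\<in>E. D z y < 2 * \<epsilon>" if y: "y \<in> Z" for y
  proof (cases "y \<in> E")
    case True
    then show ?thesis using self[of y] \<epsilon> by force
  next
    case False
    have "\<not> P (insert y E)"
    proof
      assume "P (insert y E)"
      from max[OF this] False E show False by (simp add: P_def)
    qed
    moreover have "P (insert y E)" if "\<forall>z\<in>E. N y \<inter> N z = {}"
      using that E y unfolding P_def by blast
    ultimately obtain z where z: "z \<in> E" "N y \<inter> N z \<noteq> {}" by blast
    then obtain x where "D y x < \<epsilon>" "D z x < \<epsilon>" unfolding N_def by blast
    then have "D z y < 2 * \<epsilon>" using tri[of z y x] sym[of x y] by simp
    with z(1) show ?thesis by blast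
  qed
  have "t * (\<Sum>z\<in>E. u z) \<le> (\<Sum>z\<in>E. \<Sum>x\<in>N z. c x * v x)"
    unfolding sum_distrib_left
  proof (rule sum_mono)
    fix z assume "z \<in> E"
    then have z: "z \<in> Z" using E by (auto simp: P_def)
    show "t * u z \<le> (\<Sum>x\<in>N z. c x * v x)"
    proof (cases "0 \<le> u z")
      case True
      have "t * u z \<le> (\<Sum>x\<in>N z. c x) * u z"
        using heavy[OF z] True unfolding N_def by (intro mult_right_mono) auto
      also have "\<dots> \<le> (\<Sum>x\<in>N z. c x * v x)"
        unfolding sum_distrib_right using uv[OF z] c by (intro sum_mono mult_left_mono) (auto simp: N_def)
      finally show ?thesis .
    next
      case False
      then have "t * u z \<le> 0" using t by (simp add: mult_le_0_iff)
      also have "0 \<le> (\<Sum>x\<in>N z. c x * v x)"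
        using c v N(2) by (intro sum_nonneg mult_nonneg_nonneg) auto
      finally show ?thesis .
    qed
  qed
  also have "\<dots> = (\<Sum>x\<in>(\<Union>z\<in>E. N z). c x * v x)"
    using E N by (intro sum.UNION_disjoint[symmetric]) (auto simp: P_def)
  also have "\<dots> \<le> (\<Sum>x\<in>T. c x * v x)"
    using T N c v by (intro sum_mono2) auto
  finally show ?thesis
    using E cover by (auto simp: P_def)
qed

locale bowen_system =
  fixes act :: "'g \<Rightarrow> 'x::metric_space \<Rightarrow> 'x" and F :: "nat \<Rightarrow> 'g set" and \<Phi> :: "'x \<Rightarrow> real"
  assumes compact_space: "compact (UNIV :: 'x set)"
    and finite_F: "finite (F n)" and F_nonempty: "F n \<noteq> {}"
    and continuous_act: "g \<in> F n \<Longrightarrow> continuous_on UNIV (act g)"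
    and card_F: "strict_mono (\<lambda>n. card (F n))"
    and continuous_\<Phi>: "continuous_on UNIV \<Phi>" and \<Phi>_pos: "\<Phi> x > 0"
begin

abbreviation "D n \<equiv> bowen_dist act (F n)"
abbreviation "B n \<equiv> bowen_ball act (F n)"
abbreviation "S n \<equiv> orbit_sum act \<Phi> (F n)"

lemma bowen_dist_less_iff: "D n x y < \<epsilon> \<longleftrightarrow> (\<forall>g\<in>F n. dist (act g x) (act g y) < \<epsilon>)"
  unfolding bowen_dist_def using finite_F F_nonempty by (subst Max_less_iff) auto

lemma bowen_dist_le_iff: "D n x y \<le> \<epsilon> \<longleftrightarrow> (\<forall>g\<in>F n. dist (act g x) (act g y) \<le> \<epsilon>)"
  unfolding bowen_dist_def using finite_F F_nonempty by (subst Max_le_iff) auto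

lemma bowen_dist_ge: "g \<in> F n \<Longrightarrow> dist (act g x) (act g y) \<le> D n x y"
  using bowen_dist_le_iff[of n x y "D n x y"] by simp

lemma bowen_dist_sym: "D n x y = D n y x"
  unfolding bowen_dist_def by (simp add: dist_commute)

lemma bowen_dist_triangle: "D n x z \<le> D n x y + D n y z"
  unfolding bowen_dist_le_iff
  by (meson add_mono bowen_dist_ge dist_triangle order_trans)

lemma bowen_dist_self: "D n x x = 0"
  unfolding bowen_dist_def using F_nonempty[of n] by (simp add: image_constant_conv)

lemma mem_bowen_ball: "y \<in> B n x \<epsilon> \<longleftrightarrow> D n x y < \<epsilon>"
  by (simp add: bowen_ball_def)

lemma centre_in_bowen_ball: "\<epsilon> > 0 \<Longrightarrow> x \<in> B n x \<epsilon>"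
  by (simp add: mem_bowen_ball bowen_dist_self)

lemma open_bowen_ball: "open (B n x \<epsilon>)"
proof -
  have "B n x \<epsilon> = (\<Inter>g\<in>F n. {y. dist (act g x) (act g y) < \<epsilon>})"
    by (auto simp: mem_bowen_ball bowen_dist_less_iff)
  also have "open \<dots>"
    by (intro open_INT finite_F ballI open_Collect_less continuous_intros continuous_act)
  finally show ?thesis .
qed

lemma bowen_ball_borel: "B n x \<epsilon> \<in> sets borel"
  by (intro borel_open open_bowen_ball)

lemma bowen_ball_mono: "\<epsilon> \<le> \<epsilon>' \<Longrightarrow> B n x \<epsilon> \<subseteq> B n x \<epsilon>'"
  by (auto simp: mem_bowen_ball)

lemma continuous_orbit_sum: "continuous_on UNIV (S n)"
  unfolding orbit_sum_def
  by (intro continuous_on_sum continuous_on_compose2[OF continuous_\<Phi>] continuous_act) auto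

lemma orbit_sum_pos: "S n x > 0"
  unfolding orbit_sum_def using finite_F F_nonempty by (intro sum_pos \<Phi>_pos)

lemma bdd_orbit_sum: "bdd_above (S n ` A)"
proof -
  have "compact (S n ` UNIV)"
    using compact_continuous_image continuous_orbit_sum compact_space by blast
  then have "bdd_above (S n ` UNIV)"
    by (intro bounded_imp_bdd_above compact_imp_bounded)
  then show ?thesis by (rule bdd_above_mono) auto
qed

lemma \<Phi>_lower_bound: "\<exists>m>0. \<forall>x. m \<le> \<Phi> x"
  using continuous_attains_inf[OF compact_space _ continuous_\<Phi>] \<Phi>_pos by auto

text \<open>A strictly increasing sequence of cardinalities satisfies \<open>n \<le> card (F n)\<close>, and \<open>\<Phi>\<close> is bounded away
from zero by compactness. This makes the level costs \<open>exp (- d * S n x)\<close> summable over \<open>n\<close>, uniformly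
in \<open>x\<close>.\<close>

lemma orbit_sum_growth: "\<exists>m>0. \<forall>n x. m * real n \<le> S n x"
proof -
  obtain m where m: "m > 0" "\<And>x. m \<le> \<Phi> x" using \<Phi>_lower_bound by blast
  have "m * real n \<le> S n x" for n x
  proof -
    have "m * real n \<le> m * real (card (F n))"
      using m strict_mono_imp_increasing[OF card_F, of n] by simp
    also have "\<dots> = (\<Sum>g\<in>F n. m)" by simp
    also have "\<dots> \<le> S n x" unfolding orbit_sum_def by (intro sum_mono m)
    finally show ?thesis .
  qed
  with m show ?thesis by blast
qed

text \<open>The modulus of continuity of \<open>\<Phi>\<close> gives an additive error \<open>\<eta> * m\<close> in each summand, which is a
relative error because \<open>\<Phi> \<ge> m\<close>. The bound is uniform in \<open>n\<close>, so it exchanges the supremum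
over a ball with the value at its centre at the cost of a factor \<open>1 + \<eta>\<close> in the exponent.\<close>

lemma orbit_sum_variation:
  assumes "\<eta> > 0"
  shows "\<exists>\<epsilon>0>0. \<forall>n x y. D n x y < \<epsilon>0 \<longrightarrow> S n y \<le> (1 + \<eta>) * S n x"
proof -
  obtain m where m: "m > 0" "\<And>x. m \<le> \<Phi> x" using \<Phi>_lower_bound by blast
  have "uniformly_continuous_on UNIV \<Phi>"
    using continuous_\<Phi> compact_space by (rule compact_uniformly_continuous)
  then obtain d where d: "d > 0" "\<And>x y. dist x y < d \<Longrightarrow> dist (\<Phi> x) (\<Phi> y) < \<eta> * m"
    unfolding uniformly_continuous_on_def using assms m
    by (metis UNIV_I dist_commute mult_pos_pos)
  have "S n y \<le> (1 + \<eta>) * S n x" if D: "D n x y < d" for n x y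
    unfolding orbit_sum_def sum_distrib_left
  proof (rule sum_mono)
    fix g assume "g \<in> F n"
    then have "dist (\<Phi> (act g x)) (\<Phi> (act g y)) < \<eta> * m"
      using D d(2) by (auto simp: bowen_dist_less_iff)
    moreover have "\<eta> * m \<le> \<eta> * \<Phi> (act g x)" using assms m by simp
    ultimately show "\<Phi> (act g y) \<le> (1 + \<eta>) * \<Phi> (act g x)"
      by (simp add: dist_real_def distrib_right)
  qed
  with d show ?thesis by blast
qed

section \<open>Ball families and monotonicity of the dimensions\<close>

lemma ball_families_antimono: "N \<le> N' \<Longrightarrow> ball_families N' \<subseteq> ball_families N"
  by (fastforce simp: ball_families_def)

lemma family_union_mono: "\<epsilon> \<le> \<epsilon>' \<Longrightarrow> family_union act F \<epsilon> c \<subseteq> family_union act F \<epsilon>' c"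
  unfolding family_union_def using bowen_ball_mono by (fastforce split: prod.splits)

lemma open_family_union: "open (family_union act F \<epsilon> c)"
  unfolding family_union_def by (auto split: prod.splits intro!: open_UN open_bowen_ball)

lemma family_union_borel: "family_union act F \<epsilon> c \<in> sets borel"
  by (intro borel_open open_family_union)

lemma lim_INF_families:
  fixes cost :: "nat set \<times> (nat \<Rightarrow> nat) \<times> (nat \<Rightarrow> 'x) \<Rightarrow> ennreal"
  shows "lim (\<lambda>N. INF c\<in>{c\<in>ball_families N. Q c}. cost c) = (SUP N. INF c\<in>{c\<in>ball_families N. Q c}. cost c)"
  by (intro lim_incseq_ennreal incseq_SucI INF_superset_mono)
    (use ball_families_antimono[OF le_SucI[OF order_refl]] in blast, simp)

lemma family_cost_antimono: "s \<le> s' \<Longrightarrow> family_cost act F \<Phi> s' c \<le> family_cost act F \<Phi> s c"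
  unfolding family_cost_def
  by (auto split: prod.splits intro!: infsum_ennreal_mono ennreal_leI mult_right_mono less_imp_le[OF orbit_sum_pos])

lemma family_cost_sup_mono_radius:
  assumes "0 < \<epsilon>" "\<epsilon> \<le> \<epsilon>'" "s > 0"
  shows "family_cost_sup act F \<Phi> \<epsilon>' s c \<le> family_cost_sup act F \<Phi> \<epsilon> s c"
  unfolding family_cost_sup_def
  using assms
  by (auto split: prod.splits intro!: infsum_ennreal_mono ennreal_leI cSUP_subset_mono bdd_orbit_sum bowen_ball_mono)
    (use centre_in_bowen_ball[OF assms(1)] in blast)

lemma family_cost_le_family_cost_sup:
  assumes "0 < \<epsilon>" "\<epsilon> \<le> \<epsilon>0" "s > 0" "\<eta> > 0" and var: "\<forall>n x y. D n x y < \<epsilon>0 \<longrightarrow> S n y \<le> (1 + \<eta>) * S n x"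
  shows "family_cost act F \<Phi> ((1 + \<eta>) * s) c \<le> family_cost_sup act F \<Phi> \<epsilon> s c"
proof -
  have "s * (SUP y\<in>B n x \<epsilon>. S n y) \<le> (1 + \<eta>) * s * S n x" for n x
  proof -
    have "(SUP y\<in>B n x \<epsilon>. S n y) \<le> (1 + \<eta>) * S n x"
      using assms centre_in_bowen_ball[OF assms(1), of x n] 
      by (intro cSUP_least) (auto simp: mem_bowen_ball)
    then have "s * (SUP y\<in>B n x \<epsilon>. S n y) \<le> s * ((1 + \<eta>) * S n x)"
      using assms by simp
    then show ?thesis by (simp add: mult_ac)
  qed
  then show ?thesis
    unfolding family_cost_def family_cost_sup_def
    by (auto split: prod.splits intro!: infsum_ennreal_mono ennreal_leI)
qed

lemma BS_crit_antimono: "0 < \<epsilon> \<Longrightarrow> \<epsilon> \<le> \<epsilon>' \<Longrightarrow> BS_crit act F \<Phi> H \<epsilon>' \<le> BS_crit act F \<Phi> H \<epsilon>"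
  unfolding BS_crit_def lim_INF_families
  by (intro critical_value_mono SUP_mono' INF_mono)
    (use family_union_mono[of \<epsilon> \<epsilon>'] family_cost_sup_mono_radius[of \<epsilon> \<epsilon>'] in blast)

lemma BS_crit_centre_antimono_radius:
  "\<epsilon> \<le> \<epsilon>' \<Longrightarrow> BS_crit_centre act F \<Phi> H \<epsilon>' \<le> BS_crit_centre act F \<Phi> H \<epsilon>"
  unfolding BS_crit_centre_def lim_INF_families
  by (intro critical_value_mono SUP_mono' INF_superset_mono)
    (use family_union_mono[of \<epsilon> \<epsilon>'] in blast, simp)

lemma BS_crit_centre_le:
  assumes "0 < \<epsilon>" "\<epsilon> \<le> \<epsilon>0" "\<eta> > 0" and var: "\<forall>n x y. D n x y < \<epsilon>0 \<longrightarrow> S n y \<le> (1 + \<eta>) * S n x"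
  shows "BS_crit_centre act F \<Phi> H \<epsilon> \<le> ennreal (1 + \<eta>) * BS_crit act F \<Phi> H \<epsilon>"
  unfolding BS_crit_def BS_crit_centre_def lim_INF_families
  by (rule critical_value_scale, use assms in simp)
    (intro SUP_mono' INF_mono, use family_cost_le_family_cost_sup[OF assms(1,2) _ assms(3) var] in blast)

lemma Katok_crit_antimono:
  assumes "prob_space \<mu>" "sets \<mu> = sets borel" "\<epsilon> \<le> \<epsilon>'" "\<delta> \<le> \<delta>'"
  shows "Katok_crit act F \<Phi> \<mu> \<epsilon>' \<delta>' \<le> Katok_crit act F \<Phi> \<mu> \<epsilon> \<delta>"
proof -
  interpret prob_space \<mu> by fact
  have "measure \<mu> (family_union act F \<epsilon> c) \<le> measure \<mu> (family_union act F \<epsilon>' c)" for c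
    by (intro finite_measure_mono family_union_mono assms(3)) (simp add: assms(2) family_union_borel)
  then have "1 - \<delta>' < measure \<mu> (family_union act F \<epsilon>' c)"
    if "1 - \<delta> < measure \<mu> (family_union act F \<epsilon> c)" for c
    using that assms(4) by (smt (verit))
  then show ?thesis
    unfolding Katok_crit_def lim_INF_families
    by (intro critical_value_mono SUP_mono' INF_superset_mono) (blast, simp)
qed

lemma BS_dim_eq: "BS_dim act F \<Phi> H = (SUP \<epsilon>\<in>{0<..}. BS_crit act F \<Phi> H \<epsilon>)"
  unfolding BS_dim_def by (intro Lim_at_right_antimono BS_crit_antimono)

lemma BS_dim_measure_eq: "BS_dim_measure act F \<Phi> \<mu> =
    (SUP \<epsilon>\<in>{0<..}. SUP \<delta>\<in>{0<..}. INF Z\<in>{Z \<in> sets borel. measure \<mu> Z \<ge> 1 - \<delta>}. BS_crit_centre act F \<Phi> Z \<epsilon>)"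
proof -
  have "Lim (at_right 0) (\<lambda>\<delta>. INF Z\<in>{Z \<in> sets borel. measure \<mu> Z \<ge> 1 - \<delta>}. BS_crit_centre act F \<Phi> Z \<epsilon>)
    = (SUP \<delta>\<in>{0<..}. INF Z\<in>{Z \<in> sets borel. measure \<mu> Z \<ge> 1 - \<delta>}. BS_crit_centre act F \<Phi> Z \<epsilon>)" for \<epsilon>
    by (intro Lim_at_right_antimono INF_superset_mono) auto
  then show ?thesis
    unfolding BS_dim_measure_def
    by (simp, intro Lim_at_right_antimono SUP_mono' INF_mono)
      (use BS_crit_centre_antimono_radius in blast)
qed

lemma Katok_dim_measure_eq:
  assumes "prob_space \<mu>" "sets \<mu> = sets borel"
  shows "Katok_dim_measure act F \<Phi> \<mu> = (SUP \<epsilon>\<in>{0<..}. SUP \<delta>\<in>{0<..}. Katok_crit act F \<Phi> \<mu> \<epsilon> \<delta>)"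
proof -
  have "Lim (at_right 0) (\<lambda>\<delta>. Katok_crit act F \<Phi> \<mu> \<epsilon> \<delta>) = (SUP \<delta>\<in>{0<..}. Katok_crit act F \<Phi> \<mu> \<epsilon> \<delta>)" for \<epsilon>
    by (intro Lim_at_right_antimono Katok_crit_antimono assms) auto
  then show ?thesis
    unfolding Katok_dim_measure_def
    by (simp, intro Lim_at_right_antimono SUP_mono' Katok_crit_antimono assms) auto
qed

text \<open>The set \<open>Z = H\<close> competes in the infimum that defines the dimension of \<open>\<mu>\<close>. What remains is the
passage from costs at centres to costs with suprema.\<close>

lemma BS_dim_measure_le_BS_dim:
  assumes H: "closed H" and \<mu>H: "measure \<mu> H = 1"
  shows "BS_dim_measure act F \<Phi> \<mu> \<le> BS_dim act F \<Phi> H"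
proof (rule ennreal_le_by_factor)
  fix \<eta> :: real assume \<eta>: "\<eta> > 0"
  obtain \<epsilon>0 where \<epsilon>0: "\<epsilon>0 > 0" "\<forall>n x y. D n x y < \<epsilon>0 \<longrightarrow> S n y \<le> (1 + \<eta>) * S n x"
    using orbit_sum_variation[OF \<eta>] by blast
  show "BS_dim_measure act F \<Phi> \<mu> \<le> ennreal (1 + \<eta>) * BS_dim act F \<Phi> H"
    unfolding BS_dim_measure_eq
  proof (intro SUP_least)
    fix \<epsilon> \<delta> :: real assume "\<epsilon> \<in> {0<..}" "\<delta> \<in> {0<..}"
    then have e: "0 < min \<epsilon> \<epsilon>0" "min \<epsilon> \<epsilon>0 \<le> \<epsilon>0" and \<delta>: "\<delta> > 0" using \<epsilon>0 by auto
    have "(INF Z\<in>{Z \<in> sets borel. measure \<mu> Z \<ge> 1 - \<delta>}. BS_crit_centre act F \<Phi> Z \<epsilon>) \<le> BS_crit_centre act F \<Phi> H \<epsilon>"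
      using H \<mu>H \<delta> by (intro INF_lower) auto
    also have "\<dots> \<le> BS_crit_centre act F \<Phi> H (min \<epsilon> \<epsilon>0)"
      by (rule BS_crit_centre_antimono_radius) simp
    also have "\<dots> \<le> ennreal (1 + \<eta>) * BS_crit act F \<Phi> H (min \<epsilon> \<epsilon>0)"
      by (rule BS_crit_centre_le[OF e \<eta> \<epsilon>0(2)])
    also have "\<dots> \<le> ennreal (1 + \<eta>) * BS_dim act F \<Phi> H"
      unfolding BS_dim_eq using e by (intro mult_left_mono SUP_upper) auto
    finally show "(INF Z\<in>{Z \<in> sets borel. measure \<mu> Z \<ge> 1 - \<delta>}. BS_crit_centre act F \<Phi> Z \<epsilon>) \<le> \<dots>" .
  qed
qed

text \<open>A cover of a set of measure at least \<open>1 - \<delta> / 2\<close> is a family of union larger than \<open>1 - \<delta>\<close>; halving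
\<open>\<delta>\<close> turns the weak inequality into the strict one.\<close>

lemma Katok_dim_measure_le_BS_dim_measure:
  assumes "prob_space \<mu>" "sets \<mu> = sets borel"
  shows "Katok_dim_measure act F \<Phi> \<mu> \<le> BS_dim_measure act F \<Phi> \<mu>"
  unfolding Katok_dim_measure_eq[OF assms] BS_dim_measure_eq
proof (rule SUP_mono')
  fix \<epsilon> :: real
  interpret prob_space \<mu> by fact
  show "(SUP \<delta>\<in>{0<..}. Katok_crit act F \<Phi> \<mu> \<epsilon> \<delta>) \<le>
    (SUP \<delta>\<in>{0<..}. INF Z\<in>{Z \<in> sets borel. measure \<mu> Z \<ge> 1 - \<delta>}. BS_crit_centre act F \<Phi> Z \<epsilon>)"
  proof (rule SUP_mono)
    fix \<delta> :: real assume "\<delta> \<in> {0<..}"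
    then have \<delta>: "\<delta> > 0" by simp
    have "Katok_crit act F \<Phi> \<mu> \<epsilon> \<delta> \<le> BS_crit_centre act F \<Phi> Z \<epsilon>"
      if Z: "Z \<in> sets borel" "measure \<mu> Z \<ge> 1 - \<delta> / 2" for Z
    proof -
      have "measure \<mu> (family_union act F \<epsilon> c) > 1 - \<delta>" if "Z \<subseteq> family_union act F \<epsilon> c" for c
        using finite_measure_mono[OF that] Z \<delta> by (simp add: assms(2) family_union_borel)
      then show ?thesis
        unfolding Katok_crit_def BS_crit_centre_def lim_INF_families
        by (intro critical_value_mono SUP_mono' INF_superset_mono) auto
    qed
    then show "\<exists>\<delta>'\<in>{0<..}. Katok_crit act F \<Phi> \<mu> \<epsilon> \<delta> \<le>
        (INF Z\<in>{Z \<in> sets borel. measure \<mu> Z \<ge> 1 - \<delta>'}. BS_crit_centre act F \<Phi> Z \<epsilon>)"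
      using \<delta> by (intro bexI[of _ "\<delta> / 2"] INF_greatest) auto
  qed
qed

section \<open>The lower local dimension is bounded by the Katok dimension\<close>

lemma local_dimension_eq:
  assumes "prob_space \<mu>" "sets \<mu> = sets borel"
  shows "Lim (at_right 0) (\<lambda>\<epsilon>. liminf (\<lambda>n. neg_log (measure \<mu> (B n x \<epsilon>)) / ennreal (S n x)))
    = (SUP \<epsilon>\<in>{0<..}. liminf (\<lambda>n. neg_log (measure \<mu> (B n x \<epsilon>)) / ennreal (S n x)))"
proof -
  interpret prob_space \<mu> by fact
  have "measure \<mu> (B n x \<epsilon>) \<le> measure \<mu> (B n x \<epsilon>')" if "\<epsilon> \<le> \<epsilon>'" for n \<epsilon> \<epsilon>'
    using assms by (intro finite_measure_mono bowen_ball_mono[OF that]) (simp add: bowen_ball_borel)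
  then show ?thesis
    by (auto intro!: Lim_at_right_antimono Liminf_mono always_eventually divide_right_mono_ennreal neg_log_antimono)
qed

text \<open>Egorov-type sets: wherever the local dimension exceeds \<open>s\<close>, the decay estimate holds from
some level on at some scale, and countably many of these sets exhaust all such points.\<close>

definition uniform_decay :: "'x measure \<Rightarrow> real \<Rightarrow> real \<Rightarrow> nat \<Rightarrow> 'x set" where
  "uniform_decay \<mu> s \<epsilon> N = {x. \<forall>n\<ge>N. measure \<mu> (B n x \<epsilon>) \<le> exp (- s * S n x)}"

text \<open>The measure of a Bowen ball is lower semicontinuous in its centre, because \<open>\<mu>\<close> of the ball is
approximated by \<open>\<mu>\<close> of smaller concentric balls. Hence the set is closed, and in particular Borel.\<close>

lemma closed_uniform_decay:
  assumes "prob_space \<mu>" "sets \<mu> = sets borel"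
  shows "closed (uniform_decay \<mu> s \<epsilon> N)"
proof -
  interpret prob_space \<mu> by fact
  have "open {x. exp (- s * S n x) < measure \<mu> (B n x \<epsilon>)}" (is "open ?U") for n
  proof (subst open_subopen, safe)
    fix x assume x: "exp (- s * S n x) < measure \<mu> (B n x \<epsilon>)"
    have "B n x \<epsilon> = (\<Union>k. B n x (\<epsilon> - 1 / Suc k))"
    proof (intro equalityI subsetI)
      fix y assume "y \<in> B n x \<epsilon>"
      then obtain k where "1 / Suc k < \<epsilon> - D n x y"
        using nat_approx_posE[of "\<epsilon> - D n x y"] by (auto simp: mem_bowen_ball)
      then show "y \<in> (\<Union>k. B n x (\<epsilon> - 1 / Suc k))"
        by (auto simp: mem_bowen_ball algebra_simps intro!: exI[of _ k])
    next
      fix y assume "y \<in> (\<Union>k. B n x (\<epsilon> - 1 / Suc k))"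
      then show "y \<in> B n x \<epsilon>" using bowen_ball_mono[of "\<epsilon> - 1 / Suc k" \<epsilon> for k] by force
    qed
    moreover have "(\<lambda>k. measure \<mu> (B n x (\<epsilon> - 1 / Suc k))) \<longlonglongrightarrow> measure \<mu> (\<Union>k. B n x (\<epsilon> - 1 / Suc k))"
      using assms(2) bowen_ball_borel
      by (intro finite_Lim_measure_incseq) (auto intro!: incseq_SucI bowen_ball_mono simp: frac_le)
    ultimately have "eventually (\<lambda>k. exp (- s * S n x) < measure \<mu> (B n x (\<epsilon> - 1 / Suc k))) sequentially"
      using x order_tendstoD(1) by force
    then obtain k where k: "exp (- s * S n x) < measure \<mu> (B n x (\<epsilon> - 1 / Suc k))"
      using eventually_happens' sequentially_bot by blast
    define V where "V = B n x (1 / Suc k) \<inter> {y. exp (- s * S n y) < measure \<mu> (B n x (\<epsilon> - 1 / Suc k))}"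
    have "open V"
      unfolding V_def
      by (intro open_Int open_bowen_ball open_Collect_less continuous_intros continuous_orbit_sum)
    moreover have "x \<in> V"
      unfolding V_def using k by (simp add: centre_in_bowen_ball)
    moreover have "V \<subseteq> ?U"
    proof
      fix y assume y: "y \<in> V"
      have "B n x (\<epsilon> - 1 / Suc k) \<subseteq> B n y \<epsilon>"
      proof
        fix z assume "z \<in> B n x (\<epsilon> - 1 / Suc k)"
        then show "z \<in> B n y \<epsilon>"
          using y bowen_dist_triangle[of n y z x] bowen_dist_sym[of n x y] by (auto simp: V_def mem_bowen_ball)
      qed
      then have "measure \<mu> (B n x (\<epsilon> - 1 / Suc k)) \<le> measure \<mu> (B n y \<epsilon>)"
        using assms(2) by (intro finite_measure_mono) (simp_all add: bowen_ball_borel)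
      with y show "y \<in> ?U" by (auto simp: V_def)
    qed
    ultimately show "\<exists>T. open T \<and> x \<in> T \<and> T \<subseteq> ?U" by blast
  qed
  then have "closed (\<Inter>n\<in>{N..}. - {x. exp (- s * S n x) < measure \<mu> (B n x \<epsilon>)})"
    by (intro closed_INT ballI) (simp add: closed_Compl)
  also have "(\<Inter>n\<in>{N..}. - {x. exp (- s * S n x) < measure \<mu> (B n x \<epsilon>)}) = uniform_decay \<mu> s \<epsilon> N"
    by (auto simp: uniform_decay_def not_less)
  finally show ?thesis .
qed

lemma uniform_decay_borel:
  assumes "prob_space \<mu>" "sets \<mu> = sets borel"
  shows "uniform_decay \<mu> s \<epsilon> N \<in> sets borel"
  by (intro borel_closed closed_uniform_decay assms)

text \<open>The mass distribution principle. A family of union larger than \<open>1 - \<delta>\<close> must cover a part of measure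
\<open>\<mu> A - \<delta>\<close> of the decay set \<open>A\<close>. A ball of radius \<open>\<epsilon>\<close> that meets \<open>A\<close> in a point \<open>y\<close> lies in
the ball of radius \<open>2 * \<epsilon>\<close> about \<open>y\<close>, whose measure is controlled; replacing \<open>y\<close> by the centre
costs the factor \<open>1 + \<eta>\<close>.\<close>

lemma Katok_crit_ge:
  assumes \<mu>: "prob_space \<mu>" "sets \<mu> = sets borel" and pos: "0 < s" "0 < \<epsilon>" "0 < \<eta>"
    and var: "\<forall>n x y. D n x y < \<epsilon> \<longrightarrow> S n y \<le> (1 + \<eta>) * S n x"
    and \<delta>: "\<delta> < measure \<mu> (uniform_decay \<mu> s (2 * \<epsilon>) N)"
  shows "ennreal (s / (1 + \<eta>)) \<le> Katok_crit act F \<Phi> \<mu> \<epsilon> \<delta>"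
proof -
  interpret prob_space \<mu> by fact
  define A where "A = uniform_decay \<mu> s (2 * \<epsilon>) N"
  define t where "t = s / (1 + \<eta>)"
  have t: "t > 0" using pos by (simp add: t_def)
  have A: "A \<in> events" by (simp add: A_def \<mu>(2) uniform_decay_borel[OF \<mu>])
  have ball: "emeasure \<mu> (A \<inter> B n x \<epsilon>) \<le> ennreal (exp (- t * S n x))" if n: "N \<le> n" for n x
  proof (cases "A \<inter> B n x \<epsilon> = {}")
    case False
    then obtain y where y: "y \<in> A" "D n x y < \<epsilon>" by (auto simp: mem_bowen_ball)
    have "A \<inter> B n x \<epsilon> \<subseteq> B n y (2 * \<epsilon>)"
    proof
      fix z assume "z \<in> A \<inter> B n x \<epsilon>"
      then show "z \<in> B n y (2 * \<epsilon>)"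
        using y bowen_dist_triangle[of n y z x] bowen_dist_sym[of n x y] by (auto simp: mem_bowen_ball)
    qed
    then have "emeasure \<mu> (A \<inter> B n x \<epsilon>) \<le> emeasure \<mu> (B n y (2 * \<epsilon>))"
      using \<mu>(2) by (intro emeasure_mono) (simp_all add: bowen_ball_borel)
    also have "\<dots> \<le> ennreal (exp (- s * S n y))"
      using y n unfolding A_def uniform_decay_def by (simp add: emeasure_eq_measure)
    also have "\<dots> \<le> ennreal (exp (- t * S n x))"
    proof (rule ennreal_leI)
      have "S n x \<le> (1 + \<eta>) * S n y" using var y bowen_dist_sym[of n x y] by simp
      then have "t * S n x \<le> t * ((1 + \<eta>) * S n y)" using t by simp
      also have "\<dots> = s * S n y" using pos by (simp add: t_def)
      finally show "exp (- s * S n y) \<le> exp (- t * S n x)" by simp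
    qed
    finally show ?thesis .
  qed simp
  have cost: "ennreal (measure \<mu> A - \<delta>) \<le> family_cost act F \<Phi> t c"
    if c: "c \<in> ball_families N" "measure \<mu> (family_union act F \<epsilon> c) > 1 - \<delta>" for c
  proof -
    obtain I n x where c_eq: "c = (I, n, x)" by (cases c)
    let ?U = "family_union act F \<epsilon> c"
    let ?V = "\<lambda>i. if i \<in> I then A \<inter> B (n i) (x i) \<epsilon> else {}"
    have U: "?U \<in> events" using \<mu>(2) family_union_borel[of \<epsilon> c] by simp
    have "measure \<mu> A - \<delta> \<le> measure \<mu> (A \<inter> ?U)"
    proof -
      have "measure \<mu> (A \<union> ?U) = measure \<mu> A + measure \<mu> (?U - A)"
        using A U by (rule finite_measure_Union')
      moreover have "measure \<mu> ?U = measure \<mu> (?U \<inter> A) + measure \<mu> (?U - A)"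
        using finite_measure_Diff'[OF U A] by simp
      ultimately show ?thesis
        using c(2) prob_le_1[of "A \<union> ?U"] by (simp add: Int_commute)
    qed
    then have "ennreal (measure \<mu> A - \<delta>) \<le> emeasure \<mu> (A \<inter> ?U)"
      by (simp add: emeasure_eq_measure ennreal_leI)
    also have "A \<inter> ?U = (\<Union>i. ?V i)"
      by (auto simp: family_union_def c_eq split: if_splits)
    also have "emeasure \<mu> (\<Union>i. ?V i) \<le> (\<Sum>i. emeasure \<mu> (?V i))"
      by (intro emeasure_subadditive_countably) (use A in \<open>auto simp: \<mu>(2) bowen_ball_borel\<close>)
    also have "\<dots> \<le> (\<Sum>i. if i \<in> I then ennreal (exp (- t * S (n i) (x i))) else 0)"
      using c(1) ball by (intro suminf_le) (auto simp: c_eq ball_families_def)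
    also have "\<dots> = family_cost act F \<Phi> t c"
      by (simp only: family_cost_def c_eq prod.case infsum_nat_ennreal)
    finally show ?thesis .
  qed
  show ?thesis
    unfolding Katok_crit_def lim_INF_families t_def[symmetric]
  proof (rule critical_value_ge[OF _ t])
    let ?m = "\<lambda>s. SUP N. INF c\<in>{c \<in> ball_families N. 1 - \<delta> < measure \<mu> (family_union act F \<epsilon> c)}. family_cost act F \<Phi> s c"
    show "?m s' \<le> ?m s" if "s \<le> s'" for s s'
      using that by (intro SUP_mono' INF_mono) (blast intro: family_cost_antimono)
    have "0 < ennreal (measure \<mu> A - \<delta>)" using \<delta> by (simp add: A_def)
    also have "\<dots> \<le> (INF c\<in>{c \<in> ball_families N. 1 - \<delta> < measure \<mu> (family_union act F \<epsilon> c)}. family_cost act F \<Phi> t c)"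
      by (intro INF_greatest cost) auto
    also have "\<dots> \<le> ?m t" by (rule SUP_upper) simp
    finally show "?m t \<noteq> 0" by simp
  qed
qed

lemma Katok_dim_measure_ge:
  assumes \<mu>: "prob_space \<mu>" "sets \<mu> = sets borel" and pos: "0 < s" "0 < \<epsilon>"
    and decay: "0 < measure \<mu> (uniform_decay \<mu> s \<epsilon> N)"
  shows "ennreal s \<le> Katok_dim_measure act F \<Phi> \<mu>"
proof (rule ennreal_le_by_factor)
  interpret prob_space \<mu> by fact
  fix \<eta> :: real assume \<eta>: "\<eta> > 0"
  obtain \<epsilon>0 where \<epsilon>0: "\<epsilon>0 > 0" "\<forall>n x y. D n x y < \<epsilon>0 \<longrightarrow> S n y \<le> (1 + \<eta>) * S n x"
    using orbit_sum_variation[OF \<eta>] by blast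
  define e where "e = min \<epsilon>0 (\<epsilon> / 2)"
  have e: "e > 0" "e \<le> \<epsilon>0" "2 * e \<le> \<epsilon>" using \<epsilon>0 pos by (auto simp: e_def)
  have "uniform_decay \<mu> s \<epsilon> N \<subseteq> uniform_decay \<mu> s (2 * e) N"
  proof -
    have "measure \<mu> (B n x (2 * e)) \<le> measure \<mu> (B n x \<epsilon>)" for n x
      using \<mu>(2) by (intro finite_measure_mono bowen_ball_mono e) (simp add: bowen_ball_borel)
    then show ?thesis unfolding uniform_decay_def by (blast intro: order_trans)
  qed
  then have "measure \<mu> (uniform_decay \<mu> s \<epsilon> N) \<le> measure \<mu> (uniform_decay \<mu> s (2 * e) N)"
    by (intro finite_measure_mono) (simp_all add: \<mu>(2) uniform_decay_borel[OF \<mu>])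
  with decay have a: "0 < measure \<mu> (uniform_decay \<mu> s (2 * e) N)" (is "0 < ?a") by simp
  have "ennreal (s / (1 + \<eta>)) \<le> Katok_crit act F \<Phi> \<mu> e (?a / 2)"
    using \<epsilon>0(2) e a by (intro Katok_crit_ge[OF \<mu> pos(1) e(1) \<eta>, where N = N]) auto
  also have "\<dots> \<le> Katok_dim_measure act F \<Phi> \<mu>"
    unfolding Katok_dim_measure_eq[OF \<mu>] using e a by (intro SUP_upper2[of e] SUP_upper) auto
  finally have "ennreal (1 + \<eta>) * ennreal (s / (1 + \<eta>)) \<le> ennreal (1 + \<eta>) * Katok_dim_measure act F \<Phi> \<mu>"
    by (intro mult_left_mono) auto
  then show "ennreal s \<le> ennreal (1 + \<eta>) * Katok_dim_measure act F \<Phi> \<mu>"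
    using \<eta> by (subst (asm) ennreal_mult'[symmetric]) auto
qed

text \<open>The Katok dimension bounds the local dimension almost everywhere, and a fortiori its integral. If the
integral exceeds \<open>z\<close>, the local dimension cannot be at most \<open>z\<close> almost everywhere, so one of the decay
sets has positive measure.\<close>

lemma lower_BK_le_Katok_dim_measure:
  assumes \<mu>: "prob_space \<mu>" "sets \<mu> = sets borel"
  shows "lower_BK act F \<Phi> \<mu> \<le> Katok_dim_measure act F \<Phi> \<mu>"
proof (rule dense_le)
  interpret prob_space \<mu> by fact
  fix z assume z: "z < lower_BK act F \<Phi> \<mu>"
  then obtain s where s: "z = ennreal s" "0 \<le> s" by (cases z) auto
  show "z \<le> Katok_dim_measure act F \<Phi> \<mu>"
  proof (cases "s = 0")
    case False
    with s have s0: "s > 0" by simp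
    define f where "f x = (SUP \<epsilon>\<in>{0<..}. liminf (\<lambda>n. neg_log (measure \<mu> (B n x \<epsilon>)) / ennreal (S n x)))" for x
    have decay: "\<exists>k N. x \<in> uniform_decay \<mu> s (1 / Suc k) N" if fx: "z < f x" for x
    proof -
      obtain \<epsilon> where \<epsilon>: "\<epsilon> > 0" "z < liminf (\<lambda>n. neg_log (measure \<mu> (B n x \<epsilon>)) / ennreal (S n x))"
        using fx by (auto simp: f_def less_SUP_iff)
      obtain k where k: "1 / Suc k < \<epsilon>" using nat_approx_posE[OF \<epsilon>(1)] by blast
      obtain N where N: "\<And>n. n \<ge> N \<Longrightarrow> z < neg_log (measure \<mu> (B n x \<epsilon>)) / ennreal (S n x)"
        using less_LiminfD[OF \<epsilon>(2)] unfolding eventually_sequentially by blast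
      have "measure \<mu> (B n x (1 / Suc k)) \<le> exp (- s * S n x)" if "n \<ge> N" for n
      proof -
        have "measure \<mu> (B n x (1 / Suc k)) \<le> measure \<mu> (B n x \<epsilon>)"
          using \<mu>(2) k by (intro finite_measure_mono bowen_ball_mono) (simp_all add: bowen_ball_borel)
        also have "\<dots> \<le> exp (- s * S n x)"
          using N[OF that] s s0 orbit_sum_pos by (intro less_neg_log_quotientD) auto
        finally show ?thesis .
      qed
      then show ?thesis unfolding uniform_decay_def by blast
    qed
    have "\<exists>k N. 0 < measure \<mu> (uniform_decay \<mu> s (1 / Suc k) N)"
    proof (rule ccontr)
      assume "\<not> ?thesis"
      then have "measure \<mu> (uniform_decay \<mu> s (1 / Suc k) N) = 0" for k N
        by (simp add: not_less measure_le_0_iff)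
      then have "uniform_decay \<mu> s (1 / Suc k) N \<in> null_sets \<mu>" for k N
        by (simp add: null_sets_def emeasure_eq_measure \<mu>(2) uniform_decay_borel[OF \<mu>])
      then have "AE x in \<mu>. x \<notin> uniform_decay \<mu> s (1 / Suc k) N" for k N
        by (rule AE_not_in)
      then have "AE x in \<mu>. \<forall>k N. x \<notin> uniform_decay \<mu> s (1 / Suc k) N"
        by (simp add: AE_all_countable)
      then have "AE x in \<mu>. f x \<le> z"
        by eventually_elim (use decay in \<open>force simp: not_less[symmetric]\<close>)
      then have "lower_BK act F \<Phi> \<mu> \<le> (\<integral>\<^sup>+x. z \<partial>\<mu>)"
        unfolding lower_BK_def local_dimension_eq[OF \<mu>] f_def by (rule nn_integral_mono_AE)
      then show False using z by (simp add: emeasure_space_1)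
    qed
    then obtain k N where "0 < measure \<mu> (uniform_decay \<mu> s (1 / Suc k) N)" by blast
    then show ?thesis unfolding s(1) by (intro Katok_dim_measure_ge[OF \<mu> s0]) auto
  qed (use s in simp)
qed

section \<open>A Frostman lemma for Bowen balls\<close>

text \<open>A finite weighted cover by balls of radius \<open>\<epsilon>\<close> yields an honest cover by balls of radius \<open>2 * \<epsilon>\<close>
of no larger cost, if the exponent is raised from \<open>s\<close> to \<open>s + d\<close>. Every point of \<open>H\<close> has
weight more than \<open>t n = exp (- d * m * n)\<close> on some level \<open>n\<close>, because the thresholds sum up to less than
one. The single-level covering argument loses a factor \<open>1 / t n\<close>, and the extra exponent \<open>d\<close>
together with \<open>m * n \<le> S n x\<close> absorbs it. The cost with suprema suits this step: a centre \<open>x\<close> of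
the weighted cover within \<open>\<epsilon>\<close> of \<open>z\<close> lies in the new ball about \<open>z\<close>, so the supremum over that ball
dominates \<open>S n x\<close> without any error.\<close>

lemma cover_of_weighted_cover:
  assumes pos: "0 < \<epsilon>" "0 < s" "0 < d"
    and growth: "\<And>n x. m * real n \<le> S n x"
    and levels: "\<And>K. finite K \<Longrightarrow> K \<subseteq> {N..} \<Longrightarrow> (\<Sum>n\<in>K. exp (- d * m * real n)) < 1"
    and T: "finite T" "T \<subseteq> {N..} \<times> UNIV" and c: "\<And>j. j \<in> T \<Longrightarrow> 0 \<le> c j"
    and weighted: "\<And>z. z \<in> H \<Longrightarrow> 1 \<le> (\<Sum>j\<in>T. c j * indicator (B (fst j) (snd j) \<epsilon>) z)"
  shows "\<exists>f\<in>ball_families N. H \<subseteq> family_union act F (2 * \<epsilon>) f \<and>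
    family_cost_sup act F \<Phi> (2 * \<epsilon>) (s + d) f \<le> ennreal (\<Sum>j\<in>T. c j * exp (- s * S (fst j) (snd j)))"
proof -
  define L where "L = fst ` T"
  define X where "X n = {x. (n, x) \<in> T}" for n
  define t where "t n = exp (- d * m * real n)" for n
  define u where "u n z = exp (- (s + d) * (SUP y\<in>B n z (2 * \<epsilon>). S n y))" for n z
  define v where "v n x = exp (- (s + d) * S n x)" for n x
  define Z where "Z n = {z\<in>H. t n < (\<Sum>x\<in>{x\<in>X n. D n z x < \<epsilon>}. c (n, x))}" for n
  have T_eq: "T = Sigma L X" by (force simp: L_def X_def)
  have X: "finite (X n)" for n
    using finite_imageI[OF T(1), of snd] by (rule finite_subset[rotated]) (force simp: X_def)
  have L: "finite L" "L \<subseteq> {N..}" using T by (auto simp: L_def)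
  have "\<exists>E. finite E \<and> E \<subseteq> Z n \<and> (\<forall>y\<in>Z n. \<exists>z\<in>E. D n z y < 2 * \<epsilon>) \<and>
      t n * (\<Sum>z\<in>E. u n z) \<le> (\<Sum>x\<in>X n. c (n, x) * v n x)" for n
  proof (rule separated_packing[OF bowen_dist_sym bowen_dist_triangle bowen_dist_self pos(1) X])
    show "t n > 0" by (simp add: t_def)
    show "0 \<le> c (n, x)" if "x \<in> X n" for x using that c by (simp add: X_def)
    show "0 \<le> v n x" for x by (simp add: v_def)
    show "t n < (\<Sum>x\<in>{x\<in>X n. D n z x < \<epsilon>}. c (n, x))" if "z \<in> Z n" for z
      using that by (simp add: Z_def)
    show "u n z \<le> v n x" if "D n z x < \<epsilon>" for z x
    proof -
      have "x \<in> B n z (2 * \<epsilon>)" using that pos by (simp add: mem_bowen_ball)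
      then have "S n x \<le> (SUP y\<in>B n z (2 * \<epsilon>). S n y)" by (intro cSUP_upper bdd_orbit_sum)
      then show ?thesis using pos by (simp add: u_def v_def)
    qed
  qed
  then have "\<forall>n. \<exists>E. finite E \<and> E \<subseteq> Z n \<and> (\<forall>y\<in>Z n. \<exists>z\<in>E. D n z y < 2 * \<epsilon>) \<and>
      t n * (\<Sum>z\<in>E. u n z) \<le> (\<Sum>x\<in>X n. c (n, x) * v n x)" by blast
  then obtain E where E: "\<forall>n. finite (E n) \<and> E n \<subseteq> Z n \<and> (\<forall>y\<in>Z n. \<exists>z\<in>E n. D n z y < 2 * \<epsilon>) \<and>
      t n * (\<Sum>z\<in>E n. u n z) \<le> (\<Sum>x\<in>X n. c (n, x) * v n x)" by (rule choice[THEN exE])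
  have tv: "v n x \<le> t n * exp (- s * S n x)" for n x
  proof -
    have "d * (m * real n) \<le> d * S n x" using growth pos by simp
    then show ?thesis unfolding t_def v_def by (simp flip: exp_add add: algebra_simps)
  qed
  have level_cost: "(\<Sum>z\<in>E n. u n z) \<le> (\<Sum>x\<in>X n. c (n, x) * exp (- s * S n x))" for n
  proof -
    have "t n * (\<Sum>z\<in>E n. u n z) \<le> (\<Sum>x\<in>X n. c (n, x) * v n x)" using E by blast
    also have "\<dots> \<le> (\<Sum>x\<in>X n. c (n, x) * (t n * exp (- s * S n x)))"
      using tv c by (intro sum_mono mult_left_mono) (auto simp: X_def)
    also have "\<dots> = t n * (\<Sum>x\<in>X n. c (n, x) * exp (- s * S n x))"
      by (simp add: sum_distrib_left mult_ac)
    finally show ?thesis by (simp add: t_def)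
  qed
  define P where "P = Sigma L E"
  have P: "finite P" using L E by (simp add: P_def)
  then obtain h where h: "bij_betw h {0..<card P} P"
    using ex_bij_betw_nat_finite by blast
  define f where "f = ({0..<card P}, fst \<circ> h, snd \<circ> h)"
  have h_in: "h i \<in> P" if "i < card P" for i
    using h that by (auto simp: bij_betw_def)
  have "f \<in> ball_families N"
  proof -
    have "N \<le> fst (h i)" if "i < card P" for i
      using h_in[OF that] L by (auto simp: P_def)
    then show ?thesis by (simp add: f_def ball_families_def)
  qed
  moreover have "H \<subseteq> family_union act F (2 * \<epsilon>) f"
  proof
    fix z assume z: "z \<in> H"
    have "\<exists>n\<in>L. z \<in> Z n"
    proof (rule ccontr)
      assume none: "\<not> ?thesis"
      have "1 \<le> (\<Sum>j\<in>T. c j * indicator (B (fst j) (snd j) \<epsilon>) z)" by (rule weighted[OF z])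
      also have "\<dots> = (\<Sum>n\<in>L. \<Sum>x\<in>X n. c (n, x) * indicator (B n x \<epsilon>) z)"
        unfolding T_eq using L X by (subst sum.Sigma) (simp_all add: split_beta)
      also have "\<dots> = (\<Sum>n\<in>L. \<Sum>x\<in>{x\<in>X n. D n z x < \<epsilon>}. c (n, x))"
        using X by (intro sum.cong refl sum.mono_neutral_cong_right)
          (auto simp: mem_bowen_ball bowen_dist_sym[of _ z] indicator_def)
      also have "\<dots> \<le> (\<Sum>n\<in>L. t n)"
        using none z by (intro sum_mono) (auto simp: Z_def not_less)
      also have "\<dots> < 1" unfolding t_def using L by (rule levels)
      finally show False by simp
    qed
    then obtain n where n: "n \<in> L" "z \<in> Z n" by blast
    then obtain e where e: "e \<in> E n" "D n e z < 2 * \<epsilon>" using E by blast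
    then have "(n, e) \<in> P" using n by (simp add: P_def)
    then obtain i where "i < card P" "h i = (n, e)"
      using h unfolding bij_betw_def by (metis atLeastLessThan_iff image_iff)
    then show "z \<in> family_union act F (2 * \<epsilon>) f"
      using e by (auto simp: family_union_def f_def mem_bowen_ball intro!: bexI[of _ i])
  qed
  moreover have "family_cost_sup act F \<Phi> (2 * \<epsilon>) (s + d) f
      \<le> ennreal (\<Sum>j\<in>T. c j * exp (- s * S (fst j) (snd j)))"
  proof -
    have "family_cost_sup act F \<Phi> (2 * \<epsilon>) (s + d) f
        = (\<Sum>i\<in>{0..<card P}. ennreal (case h i of (n, z) \<Rightarrow> u n z))"
      by (simp add: family_cost_sup_def f_def u_def split_beta)
    also have "\<dots> = (\<Sum>p\<in>P. ennreal (case p of (n, z) \<Rightarrow> u n z))"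
      by (rule sum.reindex_bij_betw[OF h])
    also have "\<dots> = ennreal (\<Sum>(n, z)\<in>P. u n z)"
      by (rule sum_ennreal) (auto simp: u_def)
    also have "(\<Sum>(n, z)\<in>P. u n z) = (\<Sum>n\<in>L. \<Sum>z\<in>E n. u n z)"
      unfolding P_def using L E by (subst sum.Sigma) auto
    also have "ennreal \<dots> \<le> ennreal (\<Sum>n\<in>L. \<Sum>x\<in>X n. c (n, x) * exp (- s * S n x))"
      by (intro ennreal_leI sum_mono level_cost)
    also have "(\<Sum>n\<in>L. \<Sum>x\<in>X n. c (n, x) * exp (- s * S n x)) = (\<Sum>j\<in>T. c j * exp (- s * S (fst j) (snd j)))"
      unfolding T_eq using L X by (subst sum.Sigma) (simp_all add: split_beta)
    finally show ?thesis .
  qed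
  ultimately show ?thesis by blast
qed

text \<open>Below the critical value all honest covers at exponent \<open>s + d\<close>, and hence all weighted covers at
exponent \<open>s\<close>, cost at least some \<open>\<kappa> > 0\<close> once their levels are at least \<open>N\<close>. By duality there is a finitely additive probability on \<open>H\<close> that gives the ball
\<open>B n x \<epsilon>\<close> at most \<open>exp (- s * S n x) / \<kappa>\<close> for all \<open>n \<ge> N\<close>, and these bounds survive the passage to a Borel measure
because Bowen balls are open.\<close>

lemma frostman_measure:
  assumes H: "H \<noteq> {}" "closed H" and pos: "0 < \<epsilon>" "0 < s"
    and less: "ennreal s < BS_crit act F \<Phi> H (2 * \<epsilon>)"
  shows "\<exists>\<mu>\<in>borel_probs. measure \<mu> H = 1 \<and> (\<exists>C>0. \<exists>N. \<forall>n\<ge>N. \<forall>x. measure \<mu> (B n x \<epsilon>) \<le> C * exp (- s * S n x))"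
proof -
  obtain m where m: "m > 0" "\<And>n x. m * real n \<le> S n x" using orbit_sum_growth by blast
  obtain z where z: "ennreal s < z" "z < BS_crit act F \<Phi> H (2 * \<epsilon>)" using dense[OF less] by blast
  then obtain s' where s': "z = ennreal s'" "0 \<le> s'" by (cases z) auto
  define d where "d = s' - s"
  have d: "d > 0" using z s' pos by (simp add: d_def ennreal_less_iff)
  have sd: "s + d = s'" by (simp add: d_def)
  define V where "V N = (INF f\<in>{f \<in> ball_families N. H \<subseteq> family_union act F (2 * \<epsilon>) f}.
      family_cost_sup act F \<Phi> (2 * \<epsilon>) (s + d) f)" for N
  have crit: "ennreal (s + d) < BS_crit act F \<Phi> H (2 * \<epsilon>)"
    using z s' by (simp add: sd)
  have "(SUP N. V N) \<noteq> 0"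
    unfolding V_def using below_critical_value[OF _ crit[unfolded BS_crit_def lim_INF_families]] pos d
    by simp
  then obtain N1 where N1: "V N1 \<noteq> 0" by (auto simp: SUP_eq_iff)
  obtain N2 where "\<forall>N\<ge>N2. \<forall>K. finite K \<longrightarrow> K \<subseteq> {N..} \<longrightarrow> (\<Sum>n\<in>K. exp (- (d * m) * real n)) < 1"
    using exp_tail_sums_less_one[OF mult_pos_pos[OF d m(1)]] by blast
  then have N2: "\<And>N K. N2 \<le> N \<Longrightarrow> finite K \<Longrightarrow> K \<subseteq> {N..} \<Longrightarrow> (\<Sum>n\<in>K. exp (- (d * m) * real n)) < 1"
    by blast
  define N where "N = max N1 N2"
  have "V N1 \<le> V N"
    unfolding V_def using ball_families_antimono[of N1 N]
    by (intro INF_superset_mono) (auto simp: N_def)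
  with N1 have "0 < V N" by (metis order_less_le_trans zero_less_iff_neq_zero)
  then obtain k where k: "0 < k" "k < V N" using dense by blast
  then obtain \<kappa> where \<kappa>: "k = ennreal \<kappa>" "\<kappa> > 0" by (cases k) auto
  have "\<exists>p\<in>finadd_probs H. \<forall>j\<in>{N..} \<times> UNIV. p (B (fst j) (snd j) \<epsilon>) \<le> exp (- s * S (fst j) (snd j)) / \<kappa>"
  proof (rule finadd_probs_constraints[OF H(1)])
    fix T and c :: "nat \<times> 'x \<Rightarrow> real"
    assume T: "finite T" "T \<subseteq> {N..} \<times> UNIV" and c: "\<And>j. j \<in> T \<Longrightarrow> 0 \<le> c j"
      and weighted: "\<And>x. x \<in> H \<Longrightarrow> 1 \<le> (\<Sum>j\<in>T. c j * indicator (B (fst j) (snd j) \<epsilon>) x)"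
    have "\<exists>f\<in>ball_families N. H \<subseteq> family_union act F (2 * \<epsilon>) f \<and>
      family_cost_sup act F \<Phi> (2 * \<epsilon>) (s + d) f \<le> ennreal (\<Sum>j\<in>T. c j * exp (- s * S (fst j) (snd j)))"
      using N2[of N] by (intro cover_of_weighted_cover[OF pos d m(2) _ T c weighted]) (auto simp: N_def)
    then have "V N \<le> ennreal (\<Sum>j\<in>T. c j * exp (- s * S (fst j) (snd j)))"
      unfolding V_def by (blast intro: INF_lower2)
    with k \<kappa> have "ennreal \<kappa> < ennreal (\<Sum>j\<in>T. c j * exp (- s * S (fst j) (snd j)))"
      by (simp add: order_less_le_trans)
    then have "\<kappa> < (\<Sum>j\<in>T. c j * exp (- s * S (fst j) (snd j)))"
      using \<kappa> by (simp add: ennreal_less_iff)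
    moreover have "(\<Sum>j\<in>T. c j * (exp (- s * S (fst j) (snd j)) / \<kappa>)) =
        (\<Sum>j\<in>T. c j * exp (- s * S (fst j) (snd j))) / \<kappa>"
      by (simp add: sum_divide_distrib)
    ultimately show "1 \<le> (\<Sum>j\<in>T. c j * (exp (- s * S (fst j) (snd j)) / \<kappa>))"
      using \<kappa> by simp
  qed (use \<kappa> in simp)
  then obtain p where p: "p \<in> finadd_probs H"
    "\<And>n x. n \<ge> N \<Longrightarrow> p (B n x \<epsilon>) \<le> exp (- s * S n x) / \<kappa>" by force
  obtain \<mu> where \<mu>: "\<mu> \<in> borel_probs" "measure \<mu> H = 1" "\<And>U. open U \<Longrightarrow> measure \<mu> U \<le> p U"
    using finadd_probs_regularise[OF compact_space H(2) p(1)] by blast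
  have "measure \<mu> (B n x \<epsilon>) \<le> 1 / \<kappa> * exp (- s * S n x)" if "n \<ge> N" for n x
    using order_trans[OF \<mu>(3)[OF open_bowen_ball] p(2)[OF that]] by simp
  with \<mu> \<kappa> show ?thesis by (intro bexI[of _ \<mu>] conjI exI[of _ "1 / \<kappa>"] exI[of _ N]) auto
qed

text \<open>The constant \<open>C\<close> only contributes \<open>ln C / S n x\<close>, which tends to zero.\<close>

lemma lower_BK_ge:
  assumes \<mu>: "prob_space \<mu>" "sets \<mu> = sets borel" and \<epsilon>: "\<epsilon> > 0" and C: "C > 0"
    and decay: "\<And>n x. n \<ge> N \<Longrightarrow> measure \<mu> (B n x \<epsilon>) \<le> C * exp (- s * S n x)"
  shows "ennreal s \<le> lower_BK act F \<Phi> \<mu>"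
proof -
  interpret prob_space \<mu> by fact
  obtain m where m: "m > 0" "\<And>n x. m * real n \<le> S n x" using orbit_sum_growth by blast
  have "ennreal s \<le> (SUP \<epsilon>\<in>{0<..}. liminf (\<lambda>n. neg_log (measure \<mu> (B n x \<epsilon>)) / ennreal (S n x)))" for x
  proof -
    have "filterlim (\<lambda>n. m * real n) at_top sequentially"
      using m by (intro filterlim_tendsto_pos_mult_at_top[OF tendsto_const] filterlim_real_sequentially) auto
    then have "filterlim (\<lambda>n. S n x) at_top sequentially"
      by (rule filterlim_at_top_mono) (simp add: m)
    then have "(\<lambda>n. ln C / S n x) \<longlonglongrightarrow> 0"
      by (intro tendsto_divide_0[OF tendsto_const] filterlim_at_top_imp_at_infinity)
    then have "(\<lambda>n. ennreal (s - ln C / S n x)) \<longlonglongrightarrow> ennreal (s - 0)"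
      by (intro tendsto_intros)
    then have "ennreal s = liminf (\<lambda>n. ennreal (s - ln C / S n x))"
      by (simp add: lim_imp_Liminf)
    also have "\<dots> \<le> liminf (\<lambda>n. neg_log (measure \<mu> (B n x \<epsilon>)) / ennreal (S n x))"
      by (intro Liminf_mono eventually_sequentiallyI[of N] neg_log_quotient_ge decay orbit_sum_pos C) auto
    also have "\<dots> \<le> (SUP \<epsilon>\<in>{0<..}. liminf (\<lambda>n. neg_log (measure \<mu> (B n x \<epsilon>)) / ennreal (S n x)))"
      using \<epsilon> by (intro SUP_upper) auto
    finally show ?thesis .
  qed
  then have "(\<integral>\<^sup>+x. ennreal s \<partial>\<mu>) \<le> lower_BK act F \<Phi> \<mu>"
    unfolding lower_BK_def local_dimension_eq[OF \<mu>] by (intro nn_integral_mono)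
  then show ?thesis by (simp add: emeasure_space_1)
qed

lemma BS_dim_le_SUP_lower_BK:
  assumes H: "H \<noteq> {}" "closed H"
  shows "BS_dim act F \<Phi> H \<le> (SUP \<mu>\<in>{\<mu> \<in> borel_probs. measure \<mu> H = 1}. lower_BK act F \<Phi> \<mu>)"
proof (rule dense_le)
  fix z assume z: "z < BS_dim act F \<Phi> H"
  then obtain s where s: "z = ennreal s" "0 \<le> s" by (cases z) auto
  show "z \<le> (SUP \<mu>\<in>{\<mu> \<in> borel_probs. measure \<mu> H = 1}. lower_BK act F \<Phi> \<mu>)"
  proof (cases "s = 0")
    case False
    then have s0: "s > 0" using s by simp
    obtain \<epsilon> where \<epsilon>: "\<epsilon> > 0" "ennreal s < BS_crit act F \<Phi> H \<epsilon>"
      using z s(1) by (auto simp: BS_dim_eq less_SUP_iff)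
    have "\<exists>\<mu>\<in>borel_probs. measure \<mu> H = 1 \<and>
        (\<exists>C>0. \<exists>N. \<forall>n\<ge>N. \<forall>x. measure \<mu> (B n x (\<epsilon> / 2)) \<le> C * exp (- s * S n x))"
      using \<epsilon> s0 by (intro frostman_measure[OF H]) simp_all
    then obtain \<mu> C N where \<mu>: "\<mu> \<in> borel_probs" "measure \<mu> H = 1" and "C > 0"
      and decay: "\<And>n x. n \<ge> N \<Longrightarrow> measure \<mu> (B n x (\<epsilon> / 2)) \<le> C * exp (- s * S n x)"
      by blast
    have "ennreal s \<le> lower_BK act F \<Phi> \<mu>"
    proof (rule lower_BK_ge)
      show "prob_space \<mu>" "sets \<mu> = sets borel" using \<mu>(1) by (simp_all add: borel_probs_def)
      show "\<epsilon> / 2 > 0" using \<epsilon> by simp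
    qed fact+
    also have "\<dots> \<le> (SUP \<mu>\<in>{\<mu> \<in> borel_probs. measure \<mu> H = 1}. lower_BK act F \<Phi> \<mu>)"
      using \<mu> by (intro SUP_upper) auto
    finally show ?thesis unfolding s(1) .
  qed (use s in simp)
qed

end

section \<open>The variational principle\<close>

theorem theorem1p1:
  fixes G :: "('g, 'm) monoid_scheme"
    and act :: "'g \<Rightarrow> 'x::metric_space \<Rightarrow> 'x"
    and F :: "nat \<Rightarrow> 'g set"
    and \<Phi> :: "'x \<Rightarrow> real"
    and H :: "'x set"
  assumes "group G" and "countable (carrier G)" and "infinite (carrier G)" and "amenable G"
    and "compact (UNIV :: 'x set)"
    and "group_action G UNIV act"
    and "\<And>g. g \<in> carrier G \<Longrightarrow> continuous_on UNIV (act g)"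
    and "folner_sequence G F"
    and "strict_mono (\<lambda>n. card (F n))"
    and "filterlim (\<lambda>n. card (F n)) at_top sequentially"
    and "continuous_on UNIV \<Phi>" and "\<And>x. \<Phi> x > 0"
    and "H \<noteq> {}" and "compact H"
  shows "BS_dim act F \<Phi> H = (SUP \<mu>\<in>{\<mu> \<in> borel_probs. measure \<mu> H = 1}. lower_BK act F \<Phi> \<mu>)
    \<and> (SUP \<mu>\<in>{\<mu> \<in> borel_probs. measure \<mu> H = 1}. lower_BK act F \<Phi> \<mu>)
        = (SUP \<mu>\<in>{\<mu> \<in> borel_probs. measure \<mu> H = 1}. BS_dim_measure act F \<Phi> \<mu>)
    \<and> (SUP \<mu>\<in>{\<mu> \<in> borel_probs. measure \<mu> H = 1}. BS_dim_measure act F \<Phi> \<mu>)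
        = (SUP \<mu>\<in>{\<mu> \<in> borel_probs. measure \<mu> H = 1}. Katok_dim_measure act F \<Phi> \<mu>)"
proof -
  have F: "F n \<noteq> {} \<and> finite (F n) \<and> F n \<subseteq> carrier G" for n
    using \<open>folner_sequence G F\<close> by (simp add: folner_sequence_def)
  interpret bowen_system act F \<Phi>
  proof unfold_locales
    show "continuous_on UNIV (act g)" if "g \<in> F n" for g n
      using F[of n] that assms(7) by blast
  qed (use F assms in \<open>simp_all\<close>)
  have "closed H" using \<open>compact H\<close> by (rule compact_imp_closed)
  let ?M = "{\<mu> \<in> borel_probs. measure \<mu> H = 1}"
  have M: "prob_space \<mu>" "sets \<mu> = sets borel" if "\<mu> \<in> ?M" for \<mu>
    using that by (simp_all add: borel_probs_def)
  have "(SUP \<mu>\<in>?M. lower_BK act F \<Phi> \<mu>) \<le> (SUP \<mu>\<in>?M. Katok_dim_measure act F \<Phi> \<mu>)"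
    by (rule SUP_mono) (use lower_BK_le_Katok_dim_measure M in blast)
  moreover have "(SUP \<mu>\<in>?M. Katok_dim_measure act F \<Phi> \<mu>) \<le> (SUP \<mu>\<in>?M. BS_dim_measure act F \<Phi> \<mu>)"
    by (rule SUP_mono) (use Katok_dim_measure_le_BS_dim_measure M in blast)
  moreover have "(SUP \<mu>\<in>?M. BS_dim_measure act F \<Phi> \<mu>) \<le> BS_dim act F \<Phi> H"
    by (rule SUP_least) (use BS_dim_measure_le_BS_dim \<open>closed H\<close> in blast)
  moreover have "BS_dim act F \<Phi> H \<le> (SUP \<mu>\<in>?M. lower_BK act F \<Phi> \<mu>)"
    using \<open>H \<noteq> {}\<close> \<open>closed H\<close> by (rule BS_dim_le_SUP_lower_BK)
  moreover have "d = a \<and> a = b \<and> b = k" if "a \<le> k" "k \<le> b" "b \<le> d" "d \<le> a" for a b d k :: ennreal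
    using that by (intro conjI) order+
  ultimately show ?thesis by blast
qed

end
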